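(* Let $m,n$ be nonzero integers with $|m|\geq 2$ or $|n|\geq 2$, such that the Baumslag-Solitar group $BS(m,n)$ is residually finite. Then $BS(m,n)$ admits a strongly aperiodic subshift of finite type, and $BS(m,n)$ also admits a subshift of finite type that is weakly aperiodic but not strongly aperiodic.
   Context: For nonzero integers $m,n$, $BS(m,n)=\langle a,b \mid b a^{m} b^{-1} = a^n\rangle$. A group $G$ is residually finite if for every $g\in G$ different from the identity there is a normal subgroup of finite index not containing $g$. Let $G$ be a finitely generated group with identity $e$ and $\mathcal{A}$ a finite alphabet. $G$ acts on $\mathcal{A}^G$ by $(g\cdot x)_h = x_{g^{-1}h}$. A pattern is an element $p\in\mathcal{A}^{P}$ with $P\subset G$ finite; it appears in $x\in\mathcal{A}^G$ if there is $g\in G$ with $(g\cdot x)_h=p_h$ for all $h\in P$. A subshift of finite type (SFT) on $G$ is the set of all $x\in\mathcal{A}^G$ in which no pattern of some fixed finite set of patterns appears. A configuration $x$ is strongly periodic if its orbit $\{g\cdot x\mid g\in G\}$ is finite, and weakly periodic if its stabilizer $\{g\in G\mid g\cdot x=x\}$ is not $\{e\}$. An SFT is weakly aperiodic if it is non-empty and contains no strongly periodic configuration; it is strongly aperiodic if it is non-empty and contains no weakly periodic configuration. *)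

theory Defs
  imports "HOL-Algebra.Group_Action"
begin

section \<open>Groups given by generators and relations\<close>

text \<open>The letter \<open>(s, True)\<close> stands for the generator \<open>s\<close>, the letter \<open>(s, False)\<close> for its
  formal inverse. A relation \<open>u = v\<close> is represented by the pair of words \<open>(u, v)\<close>.\<close>

type_synonym 's word = "('s \<times> bool) list"

inductive word_eq :: "('s word \<times> 's word) set \<Rightarrow> 's word \<Rightarrow> 's word \<Rightarrow> bool"
  for R :: "('s word \<times> 's word) set" where
  relation: "(u, v) \<in> R \<Longrightarrow> word_eq R u v"
| cancel: "word_eq R [(s, e), (s, \<not> e)] []"
| refl: "word_eq R u u"
| sym: "word_eq R u v \<Longrightarrow> word_eq R v u"
| trans: "word_eq R u v \<Longrightarrow> word_eq R v w \<Longrightarrow> word_eq R u w"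
| append: "word_eq R u u' \<Longrightarrow> word_eq R v v' \<Longrightarrow> word_eq R (u @ v) (u' @ v')"

definition word_class :: "('s word \<times> 's word) set \<Rightarrow> 's word \<Rightarrow> 's word set" where
  "word_class R u = {v. word_eq R u v}"

definition presented_group :: "('s word \<times> 's word) set \<Rightarrow> 's word set monoid" where
  "presented_group R =
    \<lparr> carrier = range (word_class R),
      mult = (\<lambda>X Y. \<Union>u\<in>X. \<Union>v\<in>Y. word_class R (u @ v)),
      one = word_class R [] \<rparr>"

lemma word_class_eq_iff: "word_class R u = word_class R v \<longleftrightarrow> word_eq R u v"
proof
  assume "word_class R u = word_class R v"
  then show "word_eq R u v"
    using word_eq.refl[of R v] by (simp add: word_class_def set_eq_iff)
next
  assume uv: "word_eq R u v"
  have "word_eq R u w \<longleftrightarrow> word_eq R v w" for w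
    using word_eq.trans[OF uv] word_eq.trans[OF word_eq.sym[OF uv]] by iprover
  then show "word_class R u = word_class R v"
    by (simp add: word_class_def)
qed

lemma carrier_presented_group: "carrier (presented_group R) = range (word_class R)"
  by (simp add: presented_group_def)

lemma one_presented_group: "\<one>\<^bsub>presented_group R\<^esub> = word_class R []"
  by (simp add: presented_group_def)

lemma mult_presented_group:
  "word_class R u \<otimes>\<^bsub>presented_group R\<^esub> word_class R v = word_class R (u @ v)"
proof -
  have *: "word_class R (u' @ v') = word_class R (u @ v)"
    if "u' \<in> word_class R u" "v' \<in> word_class R v" for u' v'
  proof -
    have "word_eq R (u @ v) (u' @ v')"
      using that by (intro word_eq.append) (simp_all add: word_class_def)
    then show ?thesis
      unfolding word_class_eq_iff by (rule word_eq.sym)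
  qed
  have "u \<in> word_class R u" "v \<in> word_class R v"
    by (simp_all add: word_class_def word_eq.refl)
  then have "(\<Union>u'\<in>word_class R u. \<Union>v'\<in>word_class R v. word_class R (u' @ v'))
      = word_class R (u @ v)"
    by (intro SUP_eq_const *) auto
  then show ?thesis
    by (simp add: presented_group_def)
qed

lemma word_eq_inverse:
  "word_eq R (rev (map (\<lambda>(s, e). (s, \<not> e)) u) @ u) []"
proof (induction u)
  case Nil
  show ?case by (simp add: word_eq.refl)
next
  case (Cons l u)
  obtain s e where l: "l = (s, e)" by (cases l)
  let ?u' = "rev (map (\<lambda>(s, e). (s, \<not> e)) u)"
  have "word_eq R [(s, \<not> e), (s, e)] []"
    using word_eq.cancel[of R s "\<not> e"] by simp
  then have "word_eq R (?u' @ ([(s, \<not> e), (s, e)] @ u)) (?u' @ ([] @ u))"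
    by (intro word_eq.append word_eq.refl)
  then have "word_eq R (?u' @ ([(s, \<not> e), (s, e)] @ u)) (?u' @ u)"
    by simp
  then have "word_eq R (?u' @ ([(s, \<not> e), (s, e)] @ u)) []"
    using Cons.IH by (rule word_eq.trans)
  then show ?case by (simp add: l)
qed

lemma group_presented_group: "group (presented_group R)"
proof (rule groupI)
  fix x assume "x \<in> carrier (presented_group R)"
  then obtain u where "x = word_class R u" by (auto simp: carrier_presented_group)
  then show "\<exists>y\<in>carrier (presented_group R). y \<otimes>\<^bsub>presented_group R\<^esub> x = \<one>\<^bsub>presented_group R\<^esub>"
    by (intro bexI[of _ "word_class R (rev (map (\<lambda>(s, e). (s, \<not> e)) u))"])
      (auto simp: carrier_presented_group mult_presented_group one_presented_group
        word_class_eq_iff word_eq_inverse)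
qed (auto simp: carrier_presented_group mult_presented_group one_presented_group)

section \<open>Baumslag--Solitar groups\<close>

datatype bs_gen = Gen_a | Gen_b

definition power_word :: "'s \<Rightarrow> int \<Rightarrow> 's word" where
  "power_word s k = replicate (nat \<bar>k\<bar>) (s, 0 \<le> k)"

definition BS :: "int \<Rightarrow> int \<Rightarrow> bs_gen word set monoid" where
  "BS m n = presented_group
    {(power_word Gen_b 1 @ power_word Gen_a m @ power_word Gen_b (- 1), power_word Gen_a n)}"

definition residually_finite :: "('g, 'b) monoid_scheme \<Rightarrow> bool" where
  "residually_finite G \<longleftrightarrow>
    (\<forall>g\<in>carrier G. g \<noteq> \<one>\<^bsub>G\<^esub> \<longrightarrow> (\<exists>N. N \<lhd> G \<and> finite (rcosets\<^bsub>G\<^esub> N) \<and> g \<notin> N))"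

section \<open>Subshifts of finite type\<close>

text \<open>Configurations over the alphabet \<open>A\<close> are the elements of \<open>carrier G \<rightarrow>\<^sub>E A\<close>: they take the
  value \<open>undefined\<close> outside the group, so that equality of configurations is equality of
  functions. Patterns with support \<open>P\<close> are likewise the elements of \<open>P \<rightarrow>\<^sub>E A\<close>.\<close>

definition shift :: "('g, 'b) monoid_scheme \<Rightarrow> 'g \<Rightarrow> ('g \<Rightarrow> 'c) \<Rightarrow> 'g \<Rightarrow> 'c" where
  "shift G g x = (\<lambda>h\<in>carrier G. x (inv\<^bsub>G\<^esub> g \<otimes>\<^bsub>G\<^esub> h))"

definition appears ::
    "('g, 'b) monoid_scheme \<Rightarrow> 'g set \<Rightarrow> ('g \<Rightarrow> 'c) \<Rightarrow> ('g \<Rightarrow> 'c) \<Rightarrow> bool" where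
  "appears G P p x \<longleftrightarrow> (\<exists>g\<in>carrier G. \<forall>h\<in>P. shift G g x h = p h)"

definition is_SFT :: "('g, 'b) monoid_scheme \<Rightarrow> 'c set \<Rightarrow> ('g \<Rightarrow> 'c) set \<Rightarrow> bool" where
  "is_SFT G A X \<longleftrightarrow> finite A \<and>
    (\<exists>F. finite F \<and>
      (\<forall>(P, p)\<in>F. finite P \<and> P \<subseteq> carrier G \<and> p \<in> P \<rightarrow>\<^sub>E A) \<and>
      X = {x \<in> carrier G \<rightarrow>\<^sub>E A. \<forall>(P, p)\<in>F. \<not> appears G P p x})"

definition strongly_periodic :: "('g, 'b) monoid_scheme \<Rightarrow> ('g \<Rightarrow> 'c) \<Rightarrow> bool" where
  "strongly_periodic G x \<longleftrightarrow> finite (orbit G (shift G) x)"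

definition weakly_periodic :: "('g, 'b) monoid_scheme \<Rightarrow> ('g \<Rightarrow> 'c) \<Rightarrow> bool" where
  "weakly_periodic G x \<longleftrightarrow> stabilizer G (shift G) x \<noteq> {\<one>\<^bsub>G\<^esub>}"

definition weakly_aperiodic :: "('g, 'b) monoid_scheme \<Rightarrow> ('g \<Rightarrow> 'c) set \<Rightarrow> bool" where
  "weakly_aperiodic G X \<longleftrightarrow> X \<noteq> {} \<and> (\<forall>x\<in>X. \<not> strongly_periodic G x)"

definition strongly_aperiodic :: "('g, 'b) monoid_scheme \<Rightarrow> ('g \<Rightarrow> 'c) set \<Rightarrow> bool" where
  "strongly_aperiodic G X \<longleftrightarrow> X \<noteq> {} \<and> (\<forall>x\<in>X. \<not> weakly_periodic G x)"

end

theory Submission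
  imports Defs Complex_Main
begin

text \<open>The rows \<open>g\<langle>a\<rangle>\<close> of a configuration encode vectors \<open>v(g)\<close> of \<open>\<real>\<^sup>4\<close> as averages of integral
  labels, in the manner of Kari's tilings. Carries enforce that \<open>v(g b)\<close> is \<open>v(g)\<close> times a rational unit
  quaternion and times 2 or 1/3. As 2 and 3 are multiplicatively independent, no configuration has a
  period that translates along powers of \<open>b\<close>. If moreover the unit quaternion depends on the residues
  where the edge leaves and enters its rows in such a way that Britton-reduced paths become reduced
  words in a free group, then a period moves no row at all, because nontrivial quaternions act without
  fixed points. All its conjugates are then powers of \<open>a\<close>, which is impossible: for \<open>|m| \<noteq> |n|\<close> the
  exponents could be divided forever, and for \<open>|m| = |n|\<close> the rows \<open>b\<^sup>j\<langle>a\<rangle>\<close> would have a common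
  period, hence only finitely many contents.

  With constant quaternions and \<open>|m| = |n|\<close>, a commutator of \<open>a\<close> and \<open>b a b\<^sup>-\<^sup>1\<close> fixes some
  configuration.\<close>

text \<open>Scaling by 2 and 1/3 alone cannot exclude all periods: from one row the edges a^i b lead
  to |n| different rows, to which constant factors would give the same average. A free group has to
  tell these rows apart, and it must act without fixed vectors. Rotations of space have axes; left
  multiplication by unit quaternions on R^4 has none, since q v = v with v nonzero forces q = 1.
  Rational entries keep the carries in a lattice, whence the triple 3, 4, 5 behind the two
  generators U and V. Lengths stay in [2,12): doubling [2,6) and dividing [6,12) by 3 is a bijection
  of this interval. The upper end keeps the alphabet finite; the lower end forces some coordinate to
  be at least 1 in absolute value, which makes a nonzero average visible locally. The rows of an
  arbitrary configuration are not assumed to have averages. Only partial sums are compared, up to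
  bounded errors, and a factor is recovered from their linear growth.\<close>

datatype quat = Quat (q1: complex) (q2: complex)

lemma quat_eqI: "q1 x = q1 y \<Longrightarrow> q2 x = q2 y \<Longrightarrow> x = y"
  by (cases x; cases y) simp

section \<open>The quaternions as a normed division algebra\<close>

instantiation quat :: real_normed_div_algebra
begin
definition "0 = Quat 0 0"
definition "1 = Quat 1 0"
definition "x + y = Quat (q1 x + q1 y) (q2 x + q2 y)"
definition "x - y = Quat (q1 x - q1 y) (q2 x - q2 y)"
definition "- x = Quat (- q1 x) (- q2 x)"
text \<open>\<open>Quat z w\<close> is z + w j; the conjugates come from j z = cnj z j and j j =
  -1.\<close>

definition "x * y = Quat (q1 x * q1 y - q2 x * cnj (q2 y)) (q1 x * q2 y + q2 x * cnj (q1 y))"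
definition "c *\<^sub>R x = Quat (c *\<^sub>R q1 x) (c *\<^sub>R q2 x)"
definition norm_quat: "norm x = sqrt ((cmod (q1 x))\<^sup>2 + (cmod (q2 x))\<^sup>2)"
definition "sgn (x::quat) = inverse (norm x) *\<^sub>R x"
definition "dist (x::quat) y = norm (x - y)"
definition [code del]:
  "(uniformity :: (quat \<times> quat) filter) = (INF e\<in>{0<..}. principal {(x, y). dist x y < e})"
definition [code del]:
  "open (U :: quat set) \<longleftrightarrow> (\<forall>x\<in>U. eventually (\<lambda>(x', y). x' = x \<longrightarrow> y \<in> U) uniformity)"
definition "inverse x = inverse ((norm x)\<^sup>2) *\<^sub>R Quat (cnj (q1 x)) (- q2 x)"
definition "x div (y::quat) = x * inverse y"

lemmas quat_comp_defs = zero_quat_def one_quat_def plus_quat_def minus_quat_def uminus_quat_def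
  times_quat_def scaleR_quat_def

lemma norm_quat_power2: "(norm x)\<^sup>2 = (cmod (q1 x))\<^sup>2 + (cmod (q2 x))\<^sup>2" for x :: quat
  by (simp add: norm_quat)

lemma norm_quat_zero_iff: "norm x = 0 \<longleftrightarrow> x = 0" for x :: quat
  by (cases x) (simp add: norm_quat zero_quat_def sum_power2_eq_zero_iff)

lemma quat_mult_inverse: "x \<noteq> 0 \<Longrightarrow> x * inverse x = 1 \<and> inverse x * x = 1" for x :: quat
proof -
  assume "x \<noteq> 0"
  then have nz: "(norm x)\<^sup>2 \<noteq> 0" using norm_quat_zero_iff[of x] by simp
  have e: "q1 x * cnj (q1 x) + q2 x * cnj (q2 x) = of_real ((norm x)\<^sup>2)"
    by (simp add: norm_quat_power2 complex_norm_square[symmetric] del: of_real_power)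
  have "x * inverse x = Quat (inverse ((norm x)\<^sup>2) *\<^sub>R (q1 x * cnj (q1 x) + q2 x * cnj (q2 x))) 0"
    by (simp add: inverse_quat_def times_quat_def scaleR_quat_def scaleR_conv_of_real algebra_simps)
  moreover have "inverse x * x = Quat (inverse ((norm x)\<^sup>2) *\<^sub>R (q1 x * cnj (q1 x) + q2 x * cnj (q2 x))) 0"
    by (simp add: inverse_quat_def times_quat_def scaleR_quat_def scaleR_conv_of_real algebra_simps)
  ultimately show ?thesis
    using nz unfolding e by (simp add: one_quat_def scaleR_conv_of_real flip: of_real_inverse of_real_mult del: of_real_power)
qed

instance
proof
  fix x y z :: quat and c d :: real and U :: "quat set"
  show "norm (x * y) = norm x * norm y"
  proof -
    have "(norm (x * y))\<^sup>2 = (norm x * norm y)\<^sup>2"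
      unfolding power_mult_distrib norm_quat_power2
      by (cases "q1 x"; cases "q2 x"; cases "q1 y"; cases "q2 y")
        (simp add: times_quat_def cmod_power2, simp add: algebra_simps power2_eq_square)
    then show ?thesis
      by (simp add: norm_quat power2_eq_iff_nonneg)
  qed
  show "norm (x + y) \<le> norm x + norm y"
  proof -
    have "norm (x + y) \<le> sqrt ((cmod (q1 x) + cmod (q1 y))\<^sup>2 + (cmod (q2 x) + cmod (q2 y))\<^sup>2)"
      unfolding norm_quat
      by (intro real_sqrt_le_mono add_mono power_mono) (auto simp: plus_quat_def norm_triangle_ineq)
    also have "\<dots> \<le> norm x + norm y"
      unfolding norm_quat by (rule real_sqrt_sum_squares_triangle_ineq)
    finally show ?thesis .
  qed
  show "inverse x * x = 1" "x * inverse x = 1" if "x \<noteq> 0"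
    using quat_mult_inverse[OF that] by auto
  show "inverse (0::quat) = 0"
    by (simp add: inverse_quat_def zero_quat_def scaleR_quat_def)
  show "norm (c *\<^sub>R x) = \<bar>c\<bar> * norm x"
    by (simp add: norm_quat scaleR_quat_def power_mult_distrib real_sqrt_mult flip: distrib_left)
qed (auto simp: quat_comp_defs dist_quat_def sgn_quat_def uniformity_quat_def open_quat_def
    norm_quat_zero_iff divide_quat_def algebra_simps scaleR_conv_of_real
    intro!: quat_eqI)

end

section \<open>Integral quaternions\<close>

definition int_quats :: "quat set" where
  "int_quats = {x. Re (q1 x) \<in> \<int> \<and> Im (q1 x) \<in> \<int> \<and> Re (q2 x) \<in> \<int> \<and> Im (q2 x) \<in> \<int>}"

definition quat_i :: quat where "quat_i = Quat \<i> 0"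
definition quat_j :: quat where "quat_j = Quat 0 1"

lemma int_quats_add [intro]: "x \<in> int_quats \<Longrightarrow> y \<in> int_quats \<Longrightarrow> x + y \<in> int_quats"
  by (auto simp: int_quats_def plus_quat_def)

lemma int_quats_diff [intro]: "x \<in> int_quats \<Longrightarrow> y \<in> int_quats \<Longrightarrow> x - y \<in> int_quats"
  by (auto simp: int_quats_def minus_quat_def)

lemma int_quats_minus [intro]: "x \<in> int_quats \<Longrightarrow> - x \<in> int_quats"
  by (auto simp: int_quats_def uminus_quat_def)

lemma int_quats_mult [intro]: "x \<in> int_quats \<Longrightarrow> y \<in> int_quats \<Longrightarrow> x * y \<in> int_quats"
  by (auto simp: int_quats_def times_quat_def)

lemma int_quats_0 [simp]: "0 \<in> int_quats" and int_quats_1 [simp]: "1 \<in> int_quats"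
  and int_quats_i [simp]: "quat_i \<in> int_quats" and int_quats_j [simp]: "quat_j \<in> int_quats"
  by (auto simp: int_quats_def quat_i_def quat_j_def zero_quat_def one_quat_def)

lemma of_real_quat: "of_real c = Quat (of_real c) 0"
  by (simp add: of_real_def[where 'a = quat] one_quat_def scaleR_quat_def scaleR_conv_of_real)

lemma int_quats_of_int [simp]: "of_int k \<in> int_quats"
  using of_real_quat[of "of_int k"] by (simp add: int_quats_def)

lemma int_quats_numeral [simp]: "numeral k \<in> int_quats"
  using int_quats_of_int[of "numeral k"] by simp

lemma int_quats_power [intro]: "x \<in> int_quats \<Longrightarrow> x ^ k \<in> int_quats"
  by (induction k) auto

lemma norm_quat_i [simp]: "norm quat_i = 1" and norm_quat_j [simp]: "norm quat_j = 1"
  by (simp_all add: norm_quat quat_i_def quat_j_def)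

lemma quat_i_squared: "quat_i * quat_i = -1" and quat_j_squared: "quat_j * quat_j = -1"
  and quat_j_i: "quat_j * quat_i = - (quat_i * quat_j)"
  by (simp_all add: quat_i_def quat_j_def times_quat_def one_quat_def uminus_quat_def)

lemma abs_component_le_norm:
  "\<bar>Re (q1 x)\<bar> \<le> norm x" "\<bar>Im (q1 x)\<bar> \<le> norm x" "\<bar>Re (q2 x)\<bar> \<le> norm x" "\<bar>Im (q2 x)\<bar> \<le> norm x"
proof -
  have "cmod (q1 x) \<le> norm x" "cmod (q2 x) \<le> norm x"
    by (auto simp: norm_quat intro!: real_le_rsqrt)
  then show "\<bar>Re (q1 x)\<bar> \<le> norm x" "\<bar>Im (q1 x)\<bar> \<le> norm x" "\<bar>Re (q2 x)\<bar> \<le> norm x" "\<bar>Im (q2 x)\<bar> \<le> norm x"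
    using abs_Re_le_cmod abs_Im_le_cmod order_trans by blast+
qed

lemma finite_int_quats_bounded: "finite {x \<in> int_quats. norm x \<le> C}"
proof -
  let ?K = "{-\<lceil>C\<rceil>..\<lceil>C\<rceil>}"
  let ?f = "\<lambda>(a, b, c, d). Quat (Complex (of_int a) (of_int b)) (Complex (of_int c) (of_int d))"
  have "x \<in> ?f ` (?K \<times> ?K \<times> ?K \<times> ?K)" if x: "x \<in> int_quats" "norm x \<le> C" for x
  proof -
    obtain a b c d where abcd: "Re (q1 x) = of_int a" "Im (q1 x) = of_int b"
        "Re (q2 x) = of_int c" "Im (q2 x) = of_int d"
      using x(1) by (auto simp: int_quats_def elim!: Ints_cases)
    have "x = ?f (a, b, c, d)"
      by (cases x) (simp add: abcd[symmetric])
    moreover have k: "k \<in> ?K" if "\<bar>of_int k\<bar> \<le> norm x" for k :: int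
    proof -
      have "\<bar>of_int k\<bar> \<le> C" using that x(2) by linarith
      then show ?thesis by (simp add: abs_le_iff le_ceiling_iff minus_le_iff)
    qed
    have "(a, b, c, d) \<in> ?K \<times> ?K \<times> ?K \<times> ?K"
      using abs_component_le_norm[of x] k by (auto simp only: abcd mem_Times_iff fst_conv snd_conv)
    ultimately show ?thesis by blast
  qed
  then have "{x \<in> int_quats. norm x \<le> C} \<subseteq> ?f ` (?K \<times> ?K \<times> ?K \<times> ?K)"
    by blast
  then show ?thesis
    by (rule finite_subset) simp
qed

definition quat_floor :: "quat \<Rightarrow> quat" where
  "quat_floor x = Quat (Complex (of_int \<lfloor>Re (q1 x)\<rfloor>) (of_int \<lfloor>Im (q1 x)\<rfloor>))
    (Complex (of_int \<lfloor>Re (q2 x)\<rfloor>) (of_int \<lfloor>Im (q2 x)\<rfloor>))"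

lemma quat_floor_int [simp]: "quat_floor x \<in> int_quats"
  by (simp add: quat_floor_def int_quats_def)

text \<open>Each of the four coordinates moves by at most 1, hence the bound sqrt 4.\<close>

lemma norm_quat_floor_diff: "norm (quat_floor x - x) \<le> 2"
proof -
  have *: "(of_int \<lfloor>r\<rfloor> - r)\<^sup>2 \<le> 1" for r :: real
    by (subst abs_square_le_1) linarith
  have "(norm (quat_floor x - x))\<^sup>2 \<le> 1 + 1 + (1 + 1)"
    unfolding norm_quat_power2 cmod_power2
    by (intro add_mono) (simp_all add: quat_floor_def minus_quat_def *)
  then show ?thesis
    by (auto intro: power2_le_imp_le[where y = 2 and x = "norm (quat_floor x - x)"])
qed

section \<open>A free group of unit quaternions\<close>

lemma int_quats_scaleR [intro]: "c \<in> \<int> \<Longrightarrow> x \<in> int_quats \<Longrightarrow> c *\<^sub>R x \<in> int_quats"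
  by (auto simp: int_quats_def scaleR_quat_def)

text \<open>Serves as congruence to 0 modulo 5 in the Lipschitz integers; 5 is the only prime in the
  denominators of the generators.\<close>

definition five_quats :: "quat set" where
  "five_quats = (\<lambda>z. 5 *\<^sub>R z) ` int_quats"

lemma five_quats_add [intro]: "x \<in> five_quats \<Longrightarrow> y \<in> five_quats \<Longrightarrow> x + y \<in> five_quats"
  unfolding five_quats_def image_iff by (metis scaleR_right_distrib int_quats_add)

lemma five_quats_mult [intro]: "x \<in> int_quats \<Longrightarrow> y \<in> five_quats \<Longrightarrow> x * y \<in> five_quats"
  unfolding five_quats_def image_iff by (metis int_quats_mult mult_scaleR_right)

lemma five_quats_scaleR [intro]: "c \<in> \<int> \<Longrightarrow> x \<in> five_quats \<Longrightarrow> c *\<^sub>R x \<in> five_quats"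
  unfolding five_quats_def image_iff by (metis int_quats_scaleR scaleR_left_commute)

lemma five_quats_5 [intro]: "x \<in> int_quats \<Longrightarrow> 5 *\<^sub>R x \<in> five_quats"
  by (auto simp: five_quats_def)

lemmas quat_linear = plus_quat_def minus_quat_def uminus_quat_def scaleR_quat_def
  scaleR_conv_of_real algebra_simps

definition sgb :: "bool \<Rightarrow> real" where "sgb e = (if e then 1 else -1)"

lemma sgb_int [simp]: "sgb e \<in> \<int>"
  by (auto simp: sgb_def)

text \<open>With \<tau> = i and \<tau> = j these are the rational unit quaternions U and V and, for
  the other value of \<open>e\<close>, their inverses.\<close>

definition rot :: "quat \<Rightarrow> bool \<Rightarrow> quat" where
  "rot \<tau> e = (1 / 5) *\<^sub>R (3 + (4 * sgb e) *\<^sub>R \<tau>)"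

text \<open>Modulo 5 the element \<open>3 \<plusminus> 4\<tau>\<close> has rank one, and its left multiples are
  eigenvectors of \<open>\<tau>\<close> for the eigenvalue \<open>\<plusminus>2\<close>. So this predicate records the leftmost
  letter of a reduced word.\<close>

definition rot_state :: "quat \<Rightarrow> bool \<Rightarrow> quat \<Rightarrow> bool" where
  "rot_state \<tau> e w \<longleftrightarrow> (\<exists>l::nat. 5 ^ l *\<^sub>R w \<in> int_quats \<and> 5 ^ l *\<^sub>R w \<notin> five_quats \<and>
    \<tau> * (5 ^ l *\<^sub>R w) - (2 * sgb e) *\<^sub>R (5 ^ l *\<^sub>R w) \<in> five_quats)"

text \<open>Bezout: \<open>u\<close> inverts \<open>k\<close> modulo 5.\<close>

lemma five_quats_cancel:
  assumes "of_int k *\<^sub>R z \<in> five_quats" "z \<in> int_quats" and uv: "u * k + v * 5 = 1"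
  shows "z \<in> five_quats"
proof -
  have "of_int u *\<^sub>R (of_int k *\<^sub>R z) + 5 *\<^sub>R (of_int v *\<^sub>R z) \<in> five_quats"
    using assms by (intro five_quats_add five_quats_scaleR[of "of_int u"] five_quats_5 int_quats_scaleR) auto
  also have "of_int u *\<^sub>R (of_int k *\<^sub>R z) + 5 *\<^sub>R (of_int v *\<^sub>R z) = of_int (u * k + v * 5) *\<^sub>R z"
    by (simp add: algebra_simps)
  finally show ?thesis by (simp add: uv)
qed

lemma three_quat: "(3::quat) = 3 *\<^sub>R 1"
  by (metis of_real_def of_real_numeral)

text \<open>A letter is put in front of a reduced word; \<open>ne\<close> forbids only its
  cancellation with the previous letter. The eigenvector property of the product holds for every
  \<open>z\<close>; the point is that the product does not vanish modulo 5.\<close>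

lemma rot_state_step:
  assumes w: "rot_state \<tau>' e' w" and \<tau>: "\<tau> \<in> {quat_i, quat_j}" "\<tau>' \<in> {quat_i, quat_j}"
    and ne: "\<tau> = \<tau>' \<Longrightarrow> e = e'"
  shows "rot_state \<tau> e (rot \<tau> e * w)"
proof -
  obtain l where l: "5 ^ l *\<^sub>R w \<in> int_quats" "5 ^ l *\<^sub>R w \<notin> five_quats"
      "\<tau>' * (5 ^ l *\<^sub>R w) - (2 * sgb e') *\<^sub>R (5 ^ l *\<^sub>R w) \<in> five_quats"
    using w unfolding rot_state_def by blast
  define z where "z = 5 ^ l *\<^sub>R w"
  have z: "z \<in> int_quats" "z \<notin> five_quats" and z': "\<tau>' * z - (2 * sgb e') *\<^sub>R z \<in> five_quats"
    using l by (auto simp: z_def)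
  have \<tau>int: "\<tau> \<in> int_quats" "\<tau>' \<in> int_quats" and \<tau>sq: "\<tau> * \<tau> = -1"
    using \<tau> by (auto simp: quat_i_squared quat_j_squared)
  have \<tau>sqz: "\<tau> * (\<tau> * x) = - x" for x
    by (simp add: \<tau>sq flip: mult.assoc)
  define y where "y = \<tau> * z"
  have \<tau>y: "\<tau> * y = - z" by (simp add: y_def \<tau>sqz)
  have y: "y \<in> int_quats" using z \<tau>int by (auto simp: y_def)
  define z2 where "z2 = 3 *\<^sub>R z + (4 * sgb e) *\<^sub>R y"
  have eq: "5 ^ Suc l *\<^sub>R (rot \<tau> e * w) = z2"
    by (simp add: rot_def z2_def y_def z_def algebra_simps three_quat)
  have "z2 \<in> int_quats"
    unfolding z2_def using z y by (intro int_quats_add int_quats_scaleR) auto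
  moreover have "\<tau> * z2 - (2 * sgb e) *\<^sub>R z2 \<in> five_quats"
  proof -
    have "\<tau> * z2 - (2 * sgb e) *\<^sub>R z2 = 5 *\<^sub>R (- y - (2 * sgb e) *\<^sub>R z)"
      by (cases e; rule quat_eqI)
        (simp_all add: z2_def distrib_left \<tau>y flip: y_def, simp_all add: sgb_def quat_linear)
    also have "\<dots> \<in> five_quats"
      using z y by (intro five_quats_5 int_quats_diff int_quats_minus int_quats_scaleR) auto
    finally show ?thesis .
  qed
  moreover have "z2 \<notin> five_quats"
  proof
    assume z2: "z2 \<in> five_quats"
    show False
    proof (cases "\<tau> = \<tau>'")
      case True
      \<comment> \<open>Modulo 5, \<tau> multiplies \<open>z\<close> by \<open>2 * sgb e\<close>, so
        \<open>z2\<close> becomes 3 z + 8 z = 11 z, and 11 is invertible.\<close>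
      have "z2 - (4 * sgb e) *\<^sub>R (\<tau>' * z - (2 * sgb e') *\<^sub>R z) = of_int 11 *\<^sub>R z"
        using ne[OF True]
        by (cases e; intro quat_eqI) (simp_all add: z2_def True[symmetric] sgb_def quat_linear flip: y_def)
      moreover have "z2 + (- (4 * sgb e)) *\<^sub>R (\<tau>' * z - (2 * sgb e') *\<^sub>R z) \<in> five_quats"
        using z2 z' by (intro five_quats_add five_quats_scaleR) auto
      ultimately have "of_int 11 *\<^sub>R z \<in> five_quats" by simp
      from five_quats_cancel[OF this z(1), of 1 "-2"] z(2) show False by simp
    next
      case False
      \<comment> \<open>If \<open>z2\<close> vanished modulo 5, \<open>z\<close> would be a common
        eigenvector of the anticommuting maps \<tau> and \<tau>'. Comparing the two orders of
        application gives 8 z = 0 up to sign.\<close>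
      define y' where "y' = \<tau>' * z"
      have anti: "\<tau> * y' = - (\<tau>' * y)"
        using \<tau> False by (auto simp: y_def y'_def quat_j_i simp flip: mult.assoc)
      have "(4 * sgb e) *\<^sub>R z2 + (-15) *\<^sub>R y + (-10 * sgb e) *\<^sub>R z = y + (2 * sgb e) *\<^sub>R z"
        by (cases e; intro quat_eqI) (simp_all add: z2_def sgb_def quat_linear)
      moreover have "(4 * sgb e) *\<^sub>R z2 + 5 *\<^sub>R ((-3) *\<^sub>R y) + 5 *\<^sub>R ((-2 * sgb e) *\<^sub>R z) \<in> five_quats"
        using z2 z y by (intro five_quats_add five_quats_scaleR[of "4 * sgb e"] five_quats_5 int_quats_scaleR) auto
      ultimately have A: "y + (2 * sgb e) *\<^sub>R z \<in> five_quats" by simp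
      have B: "y' - (2 * sgb e') *\<^sub>R z \<in> five_quats" using z' by (simp add: y'_def)
      have "\<tau>' * (y + (2 * sgb e) *\<^sub>R z) + \<tau> * (y' - (2 * sgb e') *\<^sub>R z)
          + ((- 2 * sgb e) *\<^sub>R (y' - (2 * sgb e') *\<^sub>R z)) + ((2 * sgb e') *\<^sub>R (y + (2 * sgb e) *\<^sub>R z))
          = of_int (if e = e' then 8 else -8) *\<^sub>R z"
        by (cases e; cases e'; simp add: distrib_left right_diff_distrib anti sgb_def flip: y_def y'_def;
            intro quat_eqI; simp add: quat_linear)
      moreover have "\<tau>' * (y + (2 * sgb e) *\<^sub>R z) + \<tau> * (y' - (2 * sgb e') *\<^sub>R z)
          + ((- 2 * sgb e) *\<^sub>R (y' - (2 * sgb e') *\<^sub>R z)) + ((2 * sgb e') *\<^sub>R (y + (2 * sgb e) *\<^sub>R z))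
          \<in> five_quats"
        using five_quats_mult[OF \<tau>int(2) A] five_quats_mult[OF \<tau>int(1) B]
          five_quats_scaleR[OF _ A, of "2 * sgb e'"] five_quats_scaleR[OF _ B, of "- 2 * sgb e"]
        by (simp only: five_quats_add Ints_mult Ints_minus Ints_numeral sgb_int)
      ultimately have "of_int (if e = e' then 8 else -8) *\<^sub>R z \<in> five_quats" by simp
      from five_quats_cancel[OF this z(1), of "if e = e' then 2 else -2" "-3"] z(2) show False by (cases "e = e'") simp_all
    qed
  qed
  ultimately show ?thesis
    unfolding rot_state_def eq[symmetric] by blast
qed

lemma not_five_div: "x \<in> \<int> \<Longrightarrow> x * 5 \<noteq> (1 :: real)"
proof
  assume "x \<in> \<int>" "x * 5 = 1"
  then obtain k :: int where "of_int k * 5 = (1 :: real)" by (auto elim: Ints_cases)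
  then have "of_int (k * 5) = (of_int 1 :: real)" by simp
  then show False unfolding of_int_eq_iff by presburger
qed

text \<open>5^l is divisible by 5 unless l = 0, and \<tau> plus or minus 2 is not, because its
  \<tau>-coordinate is 1.\<close>

lemma not_rot_state_1:
  assumes "\<tau> \<in> {quat_i, quat_j}"
  shows "\<not> rot_state \<tau> e 1"
proof
  assume "rot_state \<tau> e 1"
  then obtain l :: nat where l: "(5 ^ l *\<^sub>R 1 :: quat) \<notin> five_quats"
      "\<tau> * (5 ^ l *\<^sub>R 1) - (2 * sgb e) *\<^sub>R (5 ^ l *\<^sub>R 1) \<in> five_quats"
    by (auto simp: rot_state_def)
  have "l = 0"
  proof (rule ccontr)
    assume "l \<noteq> 0"
    then obtain k where "l = Suc k" by (cases l) auto
    then have "(5 ^ l *\<^sub>R 1 :: quat) = 5 *\<^sub>R (5 ^ k *\<^sub>R 1)" by simp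
    moreover have "(5 ^ k *\<^sub>R 1 :: quat) \<in> int_quats" by auto
    ultimately show False using l(1) by (metis five_quats_5)
  qed
  then obtain z where z: "z \<in> int_quats" "\<tau> - (2 * sgb e) *\<^sub>R 1 = 5 *\<^sub>R z"
    using l(2) by (auto simp: five_quats_def)
  then have "Im (q1 z) * 5 = 1 \<or> Re (q2 z) * 5 = 1"
    using assms
    by (cases z) (auto simp: quat_i_def quat_j_def minus_quat_def scaleR_quat_def one_quat_def complex_eq_iff)
  then show False using z(1) not_five_div by (auto simp: int_quats_def)
qed

lemma rot_state_rot:
  assumes "\<tau> \<in> {quat_i, quat_j}"
  shows "rot_state \<tau> e (rot \<tau> e)"
proof -
  have \<tau>int: "\<tau> \<in> int_quats" and \<tau>sq: "\<tau> * \<tau> = -1"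
    using assms by (auto simp: quat_i_squared quat_j_squared)
  have one: "5 ^ 1 *\<^sub>R rot \<tau> e = 3 *\<^sub>R 1 + (4 * sgb e) *\<^sub>R \<tau>"
    by (simp add: rot_def three_quat)
  have "3 *\<^sub>R 1 + (4 * sgb e) *\<^sub>R \<tau> \<in> int_quats"
    using \<tau>int by (intro int_quats_add int_quats_scaleR) auto
  moreover have "\<tau> * (3 *\<^sub>R 1 + (4 * sgb e) *\<^sub>R \<tau>) - (2 * sgb e) *\<^sub>R (3 *\<^sub>R 1 + (4 * sgb e) *\<^sub>R \<tau>) \<in> five_quats"
  proof -
    have "\<tau> * (3 *\<^sub>R 1 + (4 * sgb e) *\<^sub>R \<tau>) - (2 * sgb e) *\<^sub>R (3 *\<^sub>R 1 + (4 * sgb e) *\<^sub>R \<tau>)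
      = 5 *\<^sub>R (- \<tau> - (2 * sgb e) *\<^sub>R 1)"
      by (cases e; rule quat_eqI) (simp_all add: distrib_left \<tau>sq, simp_all add: sgb_def quat_linear)
    also have "\<dots> \<in> five_quats"
      using \<tau>int by (intro five_quats_5 int_quats_diff int_quats_minus int_quats_scaleR) auto
    finally show ?thesis .
  qed
  moreover have "3 *\<^sub>R 1 + (4 * sgb e) *\<^sub>R \<tau> \<notin> five_quats"
  proof
    assume "3 *\<^sub>R 1 + (4 * sgb e) *\<^sub>R \<tau> \<in> five_quats"
    then obtain z where z: "z \<in> int_quats" "3 *\<^sub>R 1 + (4 * sgb e) *\<^sub>R \<tau> = 5 *\<^sub>R z"
      by (auto simp: five_quats_def)
    then have "Re (q1 z) * 5 = 3"
      using assms
      by (cases z) (auto simp: quat_i_def quat_j_def plus_quat_def scaleR_quat_def one_quat_def complex_eq_iff)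
    \<comment> \<open>From 5 r = 3 follows 5 (2 r - 1) = 1.\<close>
    moreover have "2 * Re (q1 z) - 1 \<in> \<int>" using z(1) by (auto simp: int_quats_def)
    ultimately show False using not_five_div[of "2 * Re (q1 z) - 1"] by auto
  qed
  ultimately show ?thesis
    unfolding rot_state_def by (intro exI[of _ 1]) (simp only: one simp_thms)
qed

lemma norm_rot: "\<tau> \<in> {quat_i, quat_j} \<Longrightarrow> norm (rot \<tau> e) = 1"
proof -
  assume "\<tau> \<in> {quat_i, quat_j}"
  then have "(norm (rot \<tau> e))\<^sup>2 = 1"
    unfolding norm_quat_power2 cmod_power2
    by (cases e) (auto simp: rot_def sgb_def quat_i_def quat_j_def quat_linear one_quat_def
        power2_eq_square three_quat)
  then show ?thesis by (simp add: power2_eq_1_iff) (metis norm_ge_zero not_one_le_zero neg_0_le_iff_le)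
qed

lemma rot_mult_rot: "\<tau> \<in> {quat_i, quat_j} \<Longrightarrow> rot \<tau> e * rot \<tau> (\<not> e) = 1"
  by (cases e) (auto simp: rot_def sgb_def quat_i_def quat_j_def quat_linear one_quat_def times_quat_def
       three_quat complex_eq_iff)

lemma inverse_rot: "\<tau> \<in> {quat_i, quat_j} \<Longrightarrow> inverse (rot \<tau> e) = rot \<tau> (\<not> e)"
  by (intro inverse_unique rot_mult_rot)

lemma rot_int: "\<tau> \<in> {quat_i, quat_j} \<Longrightarrow> 5 *\<^sub>R rot \<tau> e \<in> int_quats"
  unfolding rot_def three_quat by simp (intro int_quats_add int_quats_scaleR; auto)

lemma rot_state_power:
  assumes "rot_state quat_j e w"
  shows "rot_state quat_i e' (rot quat_i e' ^ Suc k * w)"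
proof (induction k)
  case 0
  show ?case using rot_state_step[OF assms, of quat_i e'] by (simp add: quat_i_def quat_j_def)
next
  case (Suc k)
  then show ?case using rot_state_step[OF Suc, of quat_i e'] by (simp add: mult.assoc)
qed

lemma rot_state_power_1: "rot_state quat_i e' (rot quat_i e' ^ Suc k)"
proof (induction k)
  case 0
  show ?case using rot_state_rot[of quat_i e'] by simp
next
  case (Suc k)
  then show ?case using rot_state_step[OF Suc, of quat_i e'] by (simp add: mult.assoc)
qed

definition roti :: "int \<Rightarrow> quat" where "roti k = rot quat_i True powi k"

lemma rot_nonzero: "\<tau> \<in> {quat_i, quat_j} \<Longrightarrow> rot \<tau> e \<noteq> 0"
  using norm_rot[of \<tau> e] by auto

lemma roti_0 [simp]: "roti 0 = 1" by (simp add: roti_def)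

lemma roti_add: "roti (k + l) = roti k * roti l"
  by (simp add: roti_def power_int_add rot_nonzero)

lemma norm_roti [simp]: "norm (roti k) = 1"
  by (simp add: roti_def norm_power_int norm_rot)

lemma inverse_roti: "inverse (roti k) = roti (- k)"
  by (simp add: roti_def power_int_minus)

lemma roti_cases: "k = 0 \<and> roti k = 1 \<or> (\<exists>e j. k \<noteq> 0 \<and> roti k = rot quat_i e ^ Suc j)"
proof (cases "k = 0")
  case False
  have "roti k = rot quat_i (k > 0) ^ Suc (nat \<bar>k\<bar> - 1)"
    using False by (auto simp: roti_def power_int_def inverse_rot simp del: power_Suc)
  then show ?thesis using False by blast
qed simp

lemma rot_state_roti: "rot_state quat_j e w \<Longrightarrow> k \<noteq> 0 \<Longrightarrow> \<exists>e'. rot_state quat_i e' (roti k * w)"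
  using roti_cases[of k] rot_state_power by metis

text \<open>A power of U stands between two letters V or V^-1; these can cancel only if the power is
  trivial and the signs differ.\<close>

lemma rot_state_j_roti:
  assumes "rot_state quat_j e w" "k = 0 \<Longrightarrow> e = e'"
  shows "rot_state quat_j e' (rot quat_j e' * (roti k * w))"
proof (cases "k = 0")
  case True
  then show ?thesis using rot_state_step[OF assms(1), of quat_j e'] assms(2) by simp
next
  case False
  then show ?thesis using rot_state_roti[OF assms(1)] rot_state_step[of quat_i _ "roti k * w" quat_j e']
    by (auto simp: quat_i_def quat_j_def)
qed

lemma rot_state_j_roti_1: "rot_state quat_j e (rot quat_j e * roti k)"
proof -
  have ne: "quat_j \<noteq> quat_i" by (simp add: quat_i_def quat_j_def)
  show ?thesis
    using roti_cases[of k] rot_state_rot[of quat_j e] rot_state_step[OF rot_state_power_1, of quat_j] ne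
    by (auto simp del: power_Suc)
qed

text \<open>Multiplication by U^-k would again leave an element with a leftmost letter, and 1 has
  none.\<close>

lemma rot_state_roti_ne_1: "rot_state quat_j e (roti k * w) \<Longrightarrow> w \<noteq> 1"
proof
  assume *: "rot_state quat_j e (roti k * w)" "w = 1"
  have "roti (- k) * (roti k * w) = 1" using *(2) roti_add[of "- k" k] by simp
  then show False
    using rot_state_roti[OF *(1), of "- k"] *  not_rot_state_1[of quat_i] not_rot_state_1[of quat_j]
    by (cases "k = 0") auto
qed

lemma roti_int: "\<bar>k\<bar> \<le> int N \<Longrightarrow> 5 ^ N *\<^sub>R roti k \<in> int_quats"
proof -
  assume k: "\<bar>k\<bar> \<le> int N"
  have p: "5 ^ j *\<^sub>R rot quat_i e ^ j \<in> int_quats" for e j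
    using int_quats_power[OF rot_int[of quat_i e], of j] by (simp add: scaleR_power)
  obtain e j where j: "roti k = rot quat_i e ^ j" "j \<le> N"
    using k by (cases "k \<ge> 0") (auto simp: roti_def power_int_def inverse_rot)
  have "5 ^ N *\<^sub>R roti k = 5 ^ (N - j) *\<^sub>R (5 ^ j *\<^sub>R rot quat_i e ^ j)"
    using j by (simp flip: power_add)
  then show ?thesis using p by (auto simp del: scaleR_scaleR)
qed

section \<open>Partial sums and drift\<close>

text \<open>Signed partial sums, so that \<open>isum_add\<close> holds for all integers;
  \<open>m\<close> and \<open>n\<close> may be negative.\<close>

definition isum :: "(int \<Rightarrow> 'a::ab_group_add) \<Rightarrow> int \<Rightarrow> 'a" where
  "isum f k = (if 0 \<le> k then \<Sum>i\<in>{0..<k}. f i else - (\<Sum>i\<in>{k..<0}. f i))"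

lemma isum_0 [simp]: "isum f 0 = 0"
  by (simp add: isum_def)

lemma isum_plus1: "isum f (k + 1) = isum f k + f k"
proof (cases "0 \<le> k")
  case True
  then have "{0..<k + 1} = insert k {0..<k}" by auto
  then show ?thesis using True by (simp add: isum_def add.commute)
next
  case False
  then have "{k..<0} = insert k {k + 1..<0}" by auto
  then show ?thesis using False by (auto simp: isum_def)
qed

lemma int_shift_induct [case_names zero shift]:
  assumes "P 0" and "\<And>k :: int. P k \<longleftrightarrow> P (k + 1)"
  shows "P k"
proof (induction k rule: int_induct[where k = 0])
  case base then show ?case by (rule assms(1))
next
  case (step1 i) then show ?case using assms(2) by blast
next
  case (step2 i) then show ?case using assms(2)[of "i - 1"] by simp
qed

lemma isum_add: "isum f (k + l) = isum f k + isum (\<lambda>i. f (k + i)) l"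
proof (induction l rule: int_shift_induct)
  case (shift l)
  have "isum f (k + (l + 1)) = isum f (k + l) + f (k + l)"
    using isum_plus1[of f "k + l"] by (simp add: add.assoc)
  then show ?case by (simp add: isum_plus1)
qed simp

lemma isum_telescope:
  assumes "\<And>i. f i = F (i + 1) - F i"
  shows "isum f k = F k - F 0"
proof (induction k rule: int_shift_induct)
  case (shift k)
  show ?case by (simp add: isum_plus1 assms) (auto simp: algebra_simps)
qed simp

lemma isum_cong: "(\<And>i. \<bar>i\<bar> \<le> \<bar>k\<bar> \<Longrightarrow> f i = g i) \<Longrightarrow> isum f k = isum g k"
  unfolding isum_def by (auto intro!: sum.cong)

lemma norm_isum_le:
  fixes f :: "int \<Rightarrow> 'a::real_normed_vector"
  assumes "\<And>i. norm (f i) \<le> K"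
  shows "norm (isum f k) \<le> K * \<bar>of_int k\<bar>"
proof -
  have "norm (sum f {0..<k}) \<le> of_nat (card {0..<k}) * K" "norm (sum f {k..<0}) \<le> of_nat (card {k..<0}) * K"
    by (rule sum_norm_bound, rule assms)+
  then show ?thesis by (auto simp: isum_def mult.commute)
qed

text \<open>The row sums \<open>F\<close> and \<open>F'\<close> of two rows are compared up to a bounded error after rescaling the
  argument by \<open>\<rho>\<close> and multiplying the values by \<open>\<rho> q\<close>; for rows with an average value this says that
  the second average is \<open>q\<close> times the first one.\<close>

definition drift :: "(real \<Rightarrow> quat) \<Rightarrow> (real \<Rightarrow> quat) \<Rightarrow> real \<Rightarrow> quat \<Rightarrow> bool" where
  "drift F F' \<rho> q \<longleftrightarrow> (\<exists>C. \<forall>t. norm (F' (\<rho> * t) - \<rho> *\<^sub>R (q * F t)) \<le> C)"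

lemma drift_refl: "drift F F 1 1"
  by (auto simp: drift_def)

lemma drift_trans:
  assumes "drift F F' \<rho> q" "drift F' F'' \<rho>' q'"
  shows "drift F F'' (\<rho>' * \<rho>) (q' * q)"
proof -
  obtain C C' where C: "\<And>t. norm (F' (\<rho> * t) - \<rho> *\<^sub>R (q * F t)) \<le> C"
    and C': "\<And>t. norm (F'' (\<rho>' * t) - \<rho>' *\<^sub>R (q' * F' t)) \<le> C'"
    using assms by (auto simp: drift_def)
  have "norm (F'' (\<rho>' * \<rho> * t) - (\<rho>' * \<rho>) *\<^sub>R (q' * q * F t)) \<le> C' + \<bar>\<rho>'\<bar> * (norm q' * C)" for t
  proof -
    have "F'' (\<rho>' * \<rho> * t) - (\<rho>' * \<rho>) *\<^sub>R (q' * q * F t)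
      = (F'' (\<rho>' * (\<rho> * t)) - \<rho>' *\<^sub>R (q' * F' (\<rho> * t)))
        + \<rho>' *\<^sub>R (q' * (F' (\<rho> * t) - \<rho> *\<^sub>R (q * F t)))"
      by (simp add: algebra_simps)
    also have "norm \<dots> \<le> C' + \<bar>\<rho>'\<bar> * (norm q' * C)"
      unfolding norm_scaleR norm_mult
      by (intro norm_triangle_le add_mono C') (simp add: norm_mult mult_left_mono C)
    finally show ?thesis .
  qed
  then show ?thesis unfolding drift_def by blast
qed

lemma drift_inverse:
  assumes "drift F F' \<rho> q" "\<rho> \<noteq> 0" "q \<noteq> 0"
  shows "drift F' F (inverse \<rho>) (inverse q)"
proof -
  obtain C where C: "\<And>t. norm (F' (\<rho> * t) - \<rho> *\<^sub>R (q * F t)) \<le> C"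
    using assms by (auto simp: drift_def)
  have qq: "inverse q * (q * x) = x" for x
    using assms(3) by (simp flip: mult.assoc)
  have \<rho>t: "\<rho> * (inverse \<rho> * t) = t" for t
    using assms(2) by simp
  have "norm (F (inverse \<rho> * t) - inverse \<rho> *\<^sub>R (inverse q * F' t))
     \<le> inverse \<bar>\<rho>\<bar> * (inverse (norm q) * C)" for t
  proof -
    have "F (inverse \<rho> * t) - inverse \<rho> *\<^sub>R (inverse q * F' t)
      = - (inverse \<rho> *\<^sub>R (inverse q * (F' (\<rho> * (inverse \<rho> * t)) - \<rho> *\<^sub>R (q * F (inverse \<rho> * t)))))"
      unfolding \<rho>t by (simp add: assms qq right_diff_distrib scaleR_diff_right)
    also have "norm \<dots> = inverse \<bar>\<rho>\<bar> * (inverse (norm q) *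
        norm (F' (\<rho> * (inverse \<rho> * t)) - \<rho> *\<^sub>R (q * F (inverse \<rho> * t))))"
      by (simp add: norm_mult norm_inverse)
    also have "\<dots> \<le> inverse \<bar>\<rho>\<bar> * (inverse (norm q) * C)"
      by (intro mult_left_mono C) auto
    finally show ?thesis .
  qed
  then show ?thesis unfolding drift_def by blast
qed

text \<open>The lower bound loses 1 because row sums are evaluated at the floor of the
  argument.\<close>

definition linear_growth :: "(real \<Rightarrow> quat) \<Rightarrow> bool" where
  "linear_growth F \<longleftrightarrow> (\<exists>K C. \<forall>t. norm (F t) \<le> K * \<bar>t\<bar> + C) \<and> (\<forall>t\<ge>0. t - 1 \<le> norm (F t))"

text \<open>An upper growth rate c of \<open>F\<close> (this is \<open>P c\<close>) improves to |q|
  c, since \<rho> scales argument and value alike and cancels. Iteration brings the rate below 1,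
  against the lower bound on \<open>F\<close>.\<close>

lemma drift_self_contraction:
  assumes F: "linear_growth F" and d: "drift F F \<rho> q" "\<rho> \<noteq> 0" and q: "norm q < 1"
  shows False
proof -
  obtain C where C: "\<And>t. norm (F (\<rho> * t) - \<rho> *\<^sub>R (q * F t)) \<le> C"
    using d by (auto simp: drift_def)
  define P where "P c \<longleftrightarrow> (\<exists>C. \<forall>t. norm (F t) \<le> c * \<bar>t\<bar> + C)" for c
  have step: "P (norm q * c)" if Pc: "P c" for c
  proof -
    obtain C' where C': "\<And>t. norm (F t) \<le> c * \<bar>t\<bar> + C'" using Pc by (auto simp: P_def)
    have "norm (F t) \<le> norm q * c * \<bar>t\<bar> + (\<bar>\<rho>\<bar> * norm q * C' + C)" for t
    proof -
      have "norm (F (\<rho> * (t / \<rho>))) \<le> norm (\<rho> *\<^sub>R (q * F (t / \<rho>))) + C"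
        using C[of "t / \<rho>"] norm_triangle_ineq2[of "F (\<rho> * (t / \<rho>))" "\<rho> *\<^sub>R (q * F (t / \<rho>))"] by linarith
      also have "norm (\<rho> *\<^sub>R (q * F (t / \<rho>))) = \<bar>\<rho>\<bar> * norm q * norm (F (t / \<rho>))"
        by (simp add: norm_mult)
      also have "\<dots> \<le> \<bar>\<rho>\<bar> * norm q * (c * \<bar>t / \<rho>\<bar> + C')"
        by (intro mult_left_mono C') auto
      also have "\<dots> = norm q * c * \<bar>t\<bar> + \<bar>\<rho>\<bar> * norm q * C'"
        using d(2) by (simp add: field_simps abs_divide)
      finally show ?thesis using d(2) by simp
    qed
    then show ?thesis unfolding P_def by blast
  qed
  have ge1: "c \<ge> 1" if Pc: "P c" for c
  proof (rule ccontr)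
    assume "\<not> c \<ge> 1"
    obtain C' where C': "\<And>t. norm (F t) \<le> c * \<bar>t\<bar> + C'" using Pc by (auto simp: P_def)
    define t where "t = max 0 ((C' + 2) / (1 - c))"
    have "t \<ge> 0" by (simp add: t_def)
    then have "t - 1 \<le> c * t + C'" using C'[of t] F by (fastforce simp: linear_growth_def)
    moreover have "(1 - c) * t \<ge> C' + 2"
      using \<open>\<not> c \<ge> 1\<close> by (simp add: t_def max_def field_simps)
    ultimately show False by (simp add: algebra_simps)
  qed
  obtain K where "P K" using F by (auto simp: linear_growth_def P_def)
  have "P (norm q ^ j * K)" for j
    by (induction j) (use \<open>P K\<close> step in \<open>auto simp: mult.assoc\<close>)
  then have "norm q ^ j * K \<ge> 1" for j using ge1 by blast
  moreover have "(\<lambda>j. norm q ^ j * K) \<longlonglongrightarrow> 0 * K"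
    by (intro tendsto_mult LIMSEQ_realpow_zero tendsto_const) (use q in auto)
  ultimately have "0 * K \<ge> 1" by (intro tendsto_lowerbound[where F = sequentially]) auto
  then show False by simp
qed

lemma drift_self_norm:
  assumes F: "linear_growth F" and d: "drift F F \<rho> q" "\<rho> \<noteq> 0" "q \<noteq> 0"
  shows "norm q = 1"
proof (rule ccontr)
  assume "norm q \<noteq> 1"
  then consider "norm q < 1" | "norm (inverse q) < 1"
    using d(3) by (auto simp: norm_inverse inverse_less_1_iff) linarith
  then show False
    using drift_self_contraction[OF F d(1,2)] drift_self_contraction[OF F drift_inverse[OF d]] d(2)
    by cases simp_all
qed

text \<open>(1 - q) F is bounded while F grows linearly.\<close>

lemma drift_self_eq_1:
  assumes F: "linear_growth F" and d: "drift F F 1 q"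
  shows "q = 1"
proof (rule ccontr)
  assume "q \<noteq> 1"
  obtain C where C: "\<And>t. norm (F t - q * F t) \<le> C"
    using d by (auto simp: drift_def)
  define t where "t = max 0 ((C + 1) / norm (1 - q) + 1)"
  have "norm (1 - q) * (t - 1) \<le> norm (1 - q) * norm (F t)"
    using F by (intro mult_left_mono) (auto simp: linear_growth_def t_def)
  also have "\<dots> \<le> C" using C[of t] by (simp add: left_diff_distrib flip: norm_mult)
  finally have "norm (1 - q) * (t - 1) \<le> C" .
  moreover have "norm (1 - q) * (t - 1) \<ge> norm (1 - q) * ((C + 1) / norm (1 - q))"
    by (intro mult_left_mono) (auto simp: t_def)
  ultimately show False using \<open>q \<noteq> 1\<close> by simp
qed

section \<open>Baumslag--Solitar groups and their actions\<close>

locale baumslag_solitar =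
  fixes m n :: int
  assumes m_nonzero: "m \<noteq> 0" and n_nonzero: "n \<noteq> 0"
begin

abbreviation bs_mult (infixl "\<odot>" 70) where "x \<odot> y \<equiv> x \<otimes>\<^bsub>BS m n\<^esub> y"
abbreviation bs_inv where "bs_inv x \<equiv> inv\<^bsub>BS m n\<^esub> x"
abbreviation bs_one where "bs_one \<equiv> \<one>\<^bsub>BS m n\<^esub>"
abbreviation bs_carrier where "bs_carrier \<equiv> carrier (BS m n)"

definition bs_rel :: "(bs_gen word \<times> bs_gen word) set" where
  "bs_rel = {(power_word Gen_b 1 @ power_word Gen_a m @ power_word Gen_b (- 1), power_word Gen_a n)}"

lemma BS_eq: "BS m n = presented_group bs_rel"
  by (simp add: BS_def bs_rel_def)

sublocale group "BS m n"
  unfolding BS_eq by (rule group_presented_group)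

definition bs_word :: "bs_gen word \<Rightarrow> bs_gen word set" where
  "bs_word = word_class bs_rel"

definition bs_a where "bs_a = bs_word [(Gen_a, True)]"
definition bs_b where "bs_b = bs_word [(Gen_b, True)]"

lemma bs_word_closed [simp]: "bs_word u \<in> bs_carrier"
  by (simp add: bs_word_def BS_eq carrier_presented_group)

lemma bs_word_append: "bs_word (u @ v) = bs_word u \<odot> bs_word v"
  by (simp add: bs_word_def BS_eq mult_presented_group)

lemma bs_word_Nil: "bs_word [] = bs_one"
  by (simp add: bs_word_def BS_eq one_presented_group)

lemma bs_carrier_cases:
  assumes "g \<in> bs_carrier" obtains u where "g = bs_word u"
  using assms by (auto simp: bs_word_def BS_eq carrier_presented_group)

lemma bs_a_closed [simp]: "bs_a \<in> bs_carrier" and bs_b_closed [simp]: "bs_b \<in> bs_carrier"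
  by (simp_all add: bs_a_def bs_b_def)

lemma bs_word_inverse_letter: "bs_word [(s, False)] = bs_inv (bs_word [(s, True)])"
proof -
  have "bs_word [(s, False), (s, True)] = bs_one"
    using word_eq.cancel[of bs_rel s False]
    by (simp add: bs_word_Nil[symmetric] bs_word_def word_class_eq_iff)
  then have "bs_word [(s, False)] \<odot> bs_word [(s, True)] = bs_one"
    by (simp flip: bs_word_append)
  then show ?thesis by (simp add: inv_equality)
qed

lemma bs_induct [consumes 1, case_names one a a_inv b b_inv]:
  assumes "g \<in> bs_carrier"
    and "P bs_one"
    and "\<And>g. g \<in> bs_carrier \<Longrightarrow> P g \<Longrightarrow> P (g \<odot> bs_a)"
    and "\<And>g. g \<in> bs_carrier \<Longrightarrow> P g \<Longrightarrow> P (g \<odot> bs_inv bs_a)"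
    and "\<And>g. g \<in> bs_carrier \<Longrightarrow> P g \<Longrightarrow> P (g \<odot> bs_b)"
    and "\<And>g. g \<in> bs_carrier \<Longrightarrow> P g \<Longrightarrow> P (g \<odot> bs_inv bs_b)"
  shows "P g"
proof -
  obtain u where u: "g = bs_word u" using assms(1) by (rule bs_carrier_cases)
  have "P (bs_word u)"
  proof (induction u rule: rev_induct)
    case Nil
    then show ?case by (simp add: bs_word_Nil assms)
  next
    case (snoc l u)
    obtain s e where l: "l = (s, e)" by (cases l)
    show ?case
      using assms(3-6)[OF bs_word_closed snoc]
      by (cases s; cases e) (simp_all add: l bs_word_append bs_word_inverse_letter bs_a_def bs_b_def)
  qed
  then show ?thesis by (simp add: u)
qed

definition a_pow :: "int \<Rightarrow> bs_gen word set" where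
  "a_pow k = bs_a [^]\<^bsub>BS m n\<^esub> k"

lemma a_pow_closed [simp]: "a_pow k \<in> bs_carrier"
  by (simp add: a_pow_def)

lemma a_pow_0 [simp]: "a_pow 0 = bs_one" and a_pow_1: "a_pow 1 = bs_a"
  by (simp_all add: a_pow_def)

lemma a_pow_add: "a_pow (k + l) = a_pow k \<odot> a_pow l"
  by (simp add: a_pow_def int_pow_mult)

lemma a_pow_minus: "a_pow (- k) = bs_inv (a_pow k)"
  by (simp add: a_pow_def int_pow_neg)

lemma mult_a_pow_a_pow [simp]: "g \<in> bs_carrier \<Longrightarrow> g \<odot> a_pow k \<odot> a_pow l = g \<odot> a_pow (k + l)"
  by (simp add: a_pow_add m_assoc)

lemma bs_word_replicate: "bs_word (replicate k (s, e)) = bs_word [(s, e)] [^]\<^bsub>BS m n\<^esub> k"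
proof (induction k)
  case (Suc k)
  have "bs_word (replicate (Suc k) (s, e)) = bs_word (replicate k (s, e)) \<odot> bs_word [(s, e)]"
    by (simp flip: bs_word_append add: replicate_append_same)
  then show ?case by (simp add: Suc)
qed (simp add: bs_word_Nil)

lemma bs_word_power_word: "bs_word (power_word Gen_a k) = a_pow k"
proof (cases "0 \<le> k")
  case True
  then have "a_pow k = bs_a [^]\<^bsub>BS m n\<^esub> nat k"
    unfolding a_pow_def int_pow_def2 by simp
  then show ?thesis using True by (simp add: power_word_def bs_word_replicate bs_a_def)
next
  case False
  then have "a_pow k = bs_inv (bs_a [^]\<^bsub>BS m n\<^esub> nat \<bar>k\<bar>)"
    unfolding a_pow_def int_pow_def2 by simp
  also have "\<dots> = bs_inv bs_a [^]\<^bsub>BS m n\<^esub> nat \<bar>k\<bar>"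
    by (simp only: nat_pow_inv bs_a_closed)
  finally show ?thesis using False
    by (simp add: power_word_def bs_word_replicate bs_a_def bs_word_inverse_letter)
qed

lemma b_a_pow_m: "bs_b \<odot> a_pow m = a_pow n \<odot> bs_b"
proof -
  have "bs_word (power_word Gen_b 1 @ power_word Gen_a m @ power_word Gen_b (- 1)) = bs_word (power_word Gen_a n)"
    unfolding bs_word_def word_class_eq_iff by (rule word_eq.relation) (simp add: bs_rel_def)
  then have "bs_b \<odot> (a_pow m \<odot> bs_inv bs_b) = a_pow n"
    unfolding bs_word_append bs_word_power_word
    by (simp add: power_word_def bs_b_def bs_word_inverse_letter)
  then have "a_pow n \<odot> bs_b = bs_b \<odot> (a_pow m \<odot> bs_inv bs_b) \<odot> bs_b" by simp
  then show ?thesis by (simp add: m_assoc)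
qed

lemma b_a_pow: "bs_b \<odot> a_pow (m * k) = a_pow (n * k) \<odot> bs_b"
proof (induction k rule: int_shift_induct)
  case (shift k)
  have "bs_b \<odot> a_pow (m * (k + 1)) = bs_b \<odot> a_pow (m * k) \<odot> a_pow m"
    by (simp add: distrib_left)
  moreover have "a_pow (n * (k + 1)) \<odot> bs_b = a_pow (n * k) \<odot> (a_pow n \<odot> bs_b)"
    by (simp add: distrib_left a_pow_add m_assoc)
  moreover have "\<dots> = a_pow (n * k) \<odot> bs_b \<odot> a_pow m"
    by (simp add: m_assoc b_a_pow_m)
  ultimately show ?case
    using right_cancel[of "a_pow m" "bs_b \<odot> a_pow (m * k)" "a_pow (n * k) \<odot> bs_b"]
    by (simp del: mult_a_pow_a_pow)
qed simp

lemma b_inv_a_pow: "bs_inv bs_b \<odot> a_pow (n * k) = a_pow (m * k) \<odot> bs_inv bs_b"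
proof -
  have "bs_inv bs_b \<odot> (a_pow (n * k) \<odot> bs_b) \<odot> bs_inv bs_b = a_pow (m * k) \<odot> bs_inv bs_b"
    by (simp add: b_a_pow[symmetric] inv_solve_left m_assoc[symmetric])
  then show ?thesis by (simp add: m_assoc)
qed

end

definition ipow :: "('w \<Rightarrow> 'w) \<Rightarrow> ('w \<Rightarrow> 'w) \<Rightarrow> int \<Rightarrow> 'w \<Rightarrow> 'w" where
  "ipow \<alpha> \<alpha>' k = (if 0 \<le> k then \<alpha> ^^ nat k else \<alpha>' ^^ nat (- k))"

text \<open>A right action: \<open>fold\<close> runs words from left to right, so \<open>rel\<close>
  is the relation in the form b a^m = a^n b. The action descends to the group by induction on
  \<open>word_eq\<close>. Such actions supply both the configurations and the inequalities between
  group elements.\<close>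

lemma (in baumslag_solitar) bs_action:
  fixes \<alpha> \<alpha>' \<beta> \<beta>' :: "'w \<Rightarrow> 'w"
  assumes \<alpha>: "\<And>\<omega>. \<alpha>' (\<alpha> \<omega>) = \<omega>" "\<And>\<omega>. \<alpha> (\<alpha>' \<omega>) = \<omega>"
    and \<beta>: "\<And>\<omega>. \<beta>' (\<beta> \<omega>) = \<omega>" "\<And>\<omega>. \<beta> (\<beta>' \<omega>) = \<omega>"
    and rel: "\<And>\<omega>. ipow \<alpha> \<alpha>' m (\<beta> \<omega>) = \<beta> (ipow \<alpha> \<alpha>' n \<omega>)"
  obtains act where "\<And>\<omega>. act bs_one \<omega> = \<omega>"
    and "\<And>g h \<omega>. g \<in> bs_carrier \<Longrightarrow> h \<in> bs_carrier \<Longrightarrow> act (g \<odot> h) \<omega> = act h (act g \<omega>)"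
    and "\<And>k \<omega>. act (a_pow k) \<omega> = ipow \<alpha> \<alpha>' k \<omega>"
    and "\<And>\<omega>. act bs_b \<omega> = \<beta> \<omega>"
    and "\<And>\<omega>. act (bs_inv bs_b) \<omega> = \<beta>' \<omega>"
proof -
  define step where "step l = (case l of (Gen_a, e) \<Rightarrow> if e then \<alpha> else \<alpha>' | (Gen_b, e) \<Rightarrow> if e then \<beta> else \<beta>')"
    for l :: "bs_gen \<times> bool"
  have step_simps: "step (Gen_a, True) = \<alpha>" "step (Gen_a, False) = \<alpha>'"
      "step (Gen_b, True) = \<beta>" "step (Gen_b, False) = \<beta>'"
    by (simp_all add: step_def)
  have run_pow: "fold step (power_word Gen_a k) \<omega> = ipow \<alpha> \<alpha>' k \<omega>" for k \<omega>
    by (simp add: power_word_def ipow_def fold_replicate step_simps)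
  have run: "fold step u = fold step v" if "word_eq bs_rel u v" for u v
    using that
  proof induction
    case (relation u v)
    then show ?case
      by (auto simp: bs_rel_def fun_eq_iff run_pow)
        (simp add: power_word_def step_simps rel \<beta>)
  next
    case (cancel s e)
    then show ?case by (cases s; cases e) (auto simp: step_simps fun_eq_iff \<alpha> \<beta>)
  qed auto
  define act where "act g = fold step (SOME u. bs_word u = g)" for g
  have act_word: "act (bs_word u) = fold step u" for u
  proof -
    have "bs_word (SOME v. bs_word v = bs_word u) = bs_word u" by (rule someI) simp
    then show ?thesis unfolding act_def by (intro run) (simp add: bs_word_def word_class_eq_iff)
  qed
  show ?thesis
  proof (rule that[of act])
    show "act bs_one \<omega> = \<omega>" for \<omega>
      by (simp add: act_word flip: bs_word_Nil)
    show "act (g \<odot> h) \<omega> = act h (act g \<omega>)" if "g \<in> bs_carrier" "h \<in> bs_carrier" for g h \<omega>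
      using that by (auto elim!: bs_carrier_cases simp: act_word simp flip: bs_word_append)
    show "act (a_pow k) \<omega> = ipow \<alpha> \<alpha>' k \<omega>" for k \<omega>
      by (simp add: act_word run_pow flip: bs_word_power_word)
    show "act bs_b \<omega> = \<beta> \<omega>" "act (bs_inv bs_b) \<omega> = \<beta>' \<omega>" for \<omega>
      by (simp_all add: bs_b_def act_word step_simps flip: bs_word_inverse_letter)
  qed
qed

context baumslag_solitar begin

text \<open>Britton-reduced expressions, as a predicate on the prefix that ends with the last letter
  \<open>b\<^sup>\<plusminus>\<^sup>1\<close>; the option records the sign of that letter.\<close>

definition b_sgn :: "bool \<Rightarrow> bs_gen word set" where
  "b_sgn e = (if e then bs_b else bs_inv bs_b)"

inductive reduced :: "bs_gen word set \<Rightarrow> bool option \<Rightarrow> bool" where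
  reduced_one: "reduced bs_one None"
| reduced_step: "reduced g s \<Longrightarrow> (s = Some (\<not> e) \<Longrightarrow> \<not> (if e then n else m) dvd i) \<Longrightarrow>
    reduced (g \<odot> a_pow i \<odot> b_sgn e) (Some e)"

lemma b_sgn_closed [simp]: "b_sgn e \<in> bs_carrier"
  by (simp add: b_sgn_def)

lemma reduced_closed: "reduced g s \<Longrightarrow> g \<in> bs_carrier"
  by (induction rule: reduced.induct) auto

text \<open>Either the longer expression is reduced, or it ends in a pinch b^-1 a^(n k) b or b a^(m
  k) b^-1; the relation then turns the pinch into a power of a and removes the last letter of
  \<open>g\<close>.\<close>

lemma reduced_mult_b_sgn:
  assumes "reduced g s"
  shows "\<exists>g' s' i'. reduced g' s' \<and> g \<odot> a_pow i \<odot> b_sgn e = g' \<odot> a_pow i'"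
proof (cases "s = Some (\<not> e) \<and> (if e then n else m) dvd i")
  case False
  then have "reduced (g \<odot> a_pow i \<odot> b_sgn e) (Some e)"
    using assms by (intro reduced_step) auto
  then show ?thesis using reduced_closed by (metis a_pow_0 r_one)
next
  case True
  from assms True obtain g' s' j where g': "reduced g' s'" "g = g' \<odot> a_pow j \<odot> b_sgn (\<not> e)"
    by (auto elim: reduced.cases)
  have cl: "g' \<in> bs_carrier" using g'(1) by (rule reduced_closed)
  obtain k where k: "i = (if e then n else m) * k" using True by (auto elim!: dvdE)
  have "b_sgn (\<not> e) \<odot> a_pow i \<odot> b_sgn e = a_pow ((if e then m else n) * k)"
  proof -
    have "bs_inv bs_b \<odot> a_pow (n * k) \<odot> bs_b = a_pow (m * k)"
      by (simp add: b_inv_a_pow m_assoc)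
    moreover have "bs_b \<odot> a_pow (m * k) \<odot> bs_inv bs_b = a_pow (n * k)"
      by (simp add: b_a_pow m_assoc)
    ultimately show ?thesis by (simp add: b_sgn_def k)
  qed
  then have "g \<odot> a_pow i \<odot> b_sgn e = g' \<odot> a_pow (j + (if e then m else n) * k)"
    using cl by (simp add: g'(2) m_assoc a_pow_add)
  then show ?thesis using g'(1) by blast
qed

lemma reduced_exists:
  assumes "w \<in> bs_carrier"
  obtains g s i where "reduced g s" "w = g \<odot> a_pow i"
proof -
  have "\<exists>g s i. reduced g s \<and> w = g \<odot> a_pow i"
    using assms
  proof (induction rule: bs_induct)
    case one
    have "bs_one = bs_one \<odot> a_pow 0" by simp
    then show ?case using reduced_one by blast
  next
    case (a g)
    then obtain g' s i where *: "reduced g' s" "g = g' \<odot> a_pow i" by blast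
    then have "g \<odot> bs_a = g' \<odot> a_pow (i + 1)"
      using reduced_closed by (simp flip: a_pow_1)
    then show ?case using * by blast
  next
    case (a_inv g)
    then obtain g' s i where *: "reduced g' s" "g = g' \<odot> a_pow i" by blast
    then have "g \<odot> bs_inv bs_a = g' \<odot> a_pow (i + - 1)"
      using reduced_closed mult_a_pow_a_pow[of g' i "- 1"] by (simp add: a_pow_minus a_pow_1)
    then show ?case using * by blast
  next
    case (b g)
    then obtain g' s i where *: "reduced g' s" "g = g' \<odot> a_pow i" by blast
    then show ?case using reduced_mult_b_sgn[OF *(1), of i True] by (simp add: b_sgn_def)
  next
    case (b_inv g)
    then obtain g' s i where *: "reduced g' s" "g = g' \<odot> a_pow i" by blast
    then show ?case using reduced_mult_b_sgn[OF *(1), of i False] by (simp add: b_sgn_def)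
  qed
  then show ?thesis using that by blast
qed

end

section \<open>Subshifts given by local rules\<close>

context group begin

text \<open>The forbidden patterns are the violations of \<open>R\<close> on the window
  \<open>P\<close>. What is seen from \<open>g\<close> appears through the shift by
  \<open>inv g\<close>.\<close>

lemma is_SFT_local_rule:
  assumes A: "finite A" and P: "finite P" "P \<subseteq> carrier G"
    and local: "\<And>c c'. (\<And>p. p \<in> P \<Longrightarrow> c p = c' p) \<Longrightarrow> R c \<Longrightarrow> R c'"
  shows "is_SFT G A {x \<in> carrier G \<rightarrow>\<^sub>E A. \<forall>g\<in>carrier G. R (\<lambda>p. x (g \<otimes> p))}"
  unfolding is_SFT_def
proof (intro conjI exI[of _ "Pair P ` {p \<in> P \<rightarrow>\<^sub>E A. \<not> R p}"])
  show "finite (Pair P ` {p \<in> P \<rightarrow>\<^sub>E A. \<not> R p})"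
    using A P by (simp add: finite_PiE)
  have "(\<forall>g\<in>carrier G. R (\<lambda>p. x (g \<otimes> p))) \<longleftrightarrow> (\<forall>p\<in>P \<rightarrow>\<^sub>E A. \<not> R p \<longrightarrow> \<not> appears G P p x)"
    if x: "x \<in> carrier G \<rightarrow>\<^sub>E A" for x
  proof (intro iffI ballI impI notI)
    fix p assume "\<forall>g\<in>carrier G. R (\<lambda>p. x (g \<otimes> p))" "\<not> R p" "appears G P p x"
    then obtain g where g: "g \<in> carrier G" "\<And>h. h \<in> P \<Longrightarrow> shift G g x h = p h"
        "R (\<lambda>p. x (inv g \<otimes> p))"
      unfolding appears_def by blast
    have "R p" by (rule local[OF _ g(3)]) (use g P in \<open>force simp: shift_def\<close>)
    with \<open>\<not> R p\<close> show False by blast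
  next
    fix g assume *: "\<forall>p\<in>P \<rightarrow>\<^sub>E A. \<not> R p \<longrightarrow> \<not> appears G P p x" and g: "g \<in> carrier G"
    show "R (\<lambda>p. x (g \<otimes> p))"
    proof (rule ccontr)
      assume no: "\<not> R (\<lambda>p. x (g \<otimes> p))"
      define p where "p = (\<lambda>h\<in>P. x (g \<otimes> h))"
      have "p \<in> P \<rightarrow>\<^sub>E A" using x g P by (auto simp: p_def)
      moreover have "\<not> R p" using no local[of p "\<lambda>h. x (g \<otimes> h)"] by (auto simp: p_def)
      moreover have "appears G P p x"
        unfolding appears_def using g P by (intro bexI[of _ "inv g"]) (auto simp: shift_def p_def)
      ultimately show False using * by blast
    qed
  qed
  then show "{x \<in> carrier G \<rightarrow>\<^sub>E A. \<forall>g\<in>carrier G. R (\<lambda>p. x (g \<otimes> p))} =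
    {x \<in> carrier G \<rightarrow>\<^sub>E A. \<forall>(P, p)\<in>Pair P ` {p \<in> P \<rightarrow>\<^sub>E A. \<not> R p}. \<not> appears G P p x}"
    by auto
qed (use A P in auto)

lemma shift_eq_iff:
  assumes "x \<in> extensional (carrier G)" "h \<in> carrier G"
  shows "shift G h x = x \<longleftrightarrow> (\<forall>g\<in>carrier G. x (h \<otimes> g) = x g)"
proof
  assume *: "shift G h x = x"
  show "\<forall>g\<in>carrier G. x (h \<otimes> g) = x g"
  proof
    fix g assume g: "g \<in> carrier G"
    have "x (h \<otimes> g) = shift G h x (h \<otimes> g)" by (simp add: *)
    also have "\<dots> = x g" using assms g by (simp add: shift_def flip: m_assoc)
    finally show "x (h \<otimes> g) = x g" .
  qed
next
  assume *: "\<forall>g\<in>carrier G. x (h \<otimes> g) = x g"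
  show "shift G h x = x"
  proof (rule extensionalityI[OF _ assms(1)])
    show "shift G h x \<in> extensional (carrier G)" by (simp add: shift_def)
    fix g assume g: "g \<in> carrier G"
    then have "x (h \<otimes> (inv h \<otimes> g)) = x (inv h \<otimes> g)" using * assms by blast
    then show "shift G h x g = x g" using g assms by (simp add: shift_def flip: m_assoc)
  qed
qed

lemma weakly_periodic_iff:
  assumes "x \<in> extensional (carrier G)"
  shows "weakly_periodic G x \<longleftrightarrow> (\<exists>h\<in>carrier G. h \<noteq> \<one> \<and> (\<forall>g\<in>carrier G. x (h \<otimes> g) = x g))"
proof -
  have "\<one> \<in> stabilizer G (shift G) x"
    using shift_eq_iff[OF assms one_closed] by (simp add: stabilizer_def)
  then show ?thesis
    unfolding weakly_periodic_def using shift_eq_iff[OF assms] by (auto simp: stabilizer_def)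
qed

text \<open>Two powers of \<open>g\<close> move \<open>x\<close> to the same point of its finite
  orbit.\<close>

lemma strongly_periodic_pow:
  assumes "strongly_periodic G x" "g \<in> carrier G"
  obtains d :: nat where "d > 0" "\<And>h. h \<in> carrier G \<Longrightarrow> x (g [^] d \<otimes> h) = x h"
proof -
  have "finite ((\<lambda>j::nat. shift G (g [^] j) x) ` UNIV)"
    by (rule finite_subset[OF _ assms(1)[unfolded strongly_periodic_def]])
      (use assms(2) in \<open>auto simp: orbit_def\<close>)
  then have "\<not> inj (\<lambda>j::nat. shift G (g [^] j) x)"
    using finite_imageD infinite_UNIV_nat by blast
  then obtain i j :: nat where "i \<noteq> j" "shift G (g [^] i) x = shift G (g [^] j) x"
    unfolding inj_on_def by blast
  then obtain i j :: nat where ij: "i < j" "shift G (g [^] i) x = shift G (g [^] j) x"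
    by (metis linorder_neqE_nat)
  show ?thesis
  proof (rule that[of "j - i"])
    show "j - i > 0" using ij by simp
    fix h assume h: "h \<in> carrier G"
    have e: "g [^] j = g [^] i \<otimes> g [^] (j - i)" using ij assms by (simp add: nat_pow_mult)
    have "shift G (g [^] i) x (g [^] j \<otimes> h) = shift G (g [^] j) x (g [^] j \<otimes> h)" by (simp add: ij)
    moreover have "inv (g [^] i) \<otimes> (g [^] j \<otimes> h) = g [^] (j - i) \<otimes> h"
      using assms h by (simp add: e m_assoc inv_solve_left')
    moreover have "inv (g [^] j) \<otimes> (g [^] j \<otimes> h) = h"
      using assms h by (simp flip: m_assoc)
    ultimately show "x (g [^] (j - i) \<otimes> h) = x h"
      using assms h by (simp add: shift_def)
  qed
qed

end

section \<open>The local rules\<close>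

text \<open>A symbol carries the position in its row modulo \<open>|m n|\<close>, the choice of the factor 2 or 1/3,
  a unit quaternion which certifies that the row has a nonzero average, an integral quaternion
  (the row encodes the average of these) and the carry of the multiplication.\<close>

datatype sym = Sym (mark: int) (rflag: bool) (direction: quat) (lab: quat) (carry: quat)

definition scale_factor :: "bool \<Rightarrow> real" where
  "scale_factor r = (if r then 2 else 1 / 3)"

text \<open>\<open>turn i j\<close> belongs to an edge which leaves its row at position i and
  arrives at position j. It sees only i modulo n and j modulo m, because a^n b = b a^m shifts both
  ends at once. \<open>D\<close> is a common denominator.\<close>

locale multiplier = baumslag_solitar +
  fixes turn :: "int \<Rightarrow> int \<Rightarrow> quat" and D :: int
  assumes D_pos: "D > 0"
    and norm_turn: "norm (turn i j) = 1"
    and turn_shift_n: "turn (i + n) j = turn i j"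
    and turn_shift_m: "turn i (j + m) = turn i j"
    and turn_int: "of_int D *\<^sub>R turn i j \<in> int_quats"
begin

text \<open>One residue modulo |m n| determines the residues modulo m and modulo n.\<close>

definition modulus :: int where "modulus = \<bar>m * n\<bar>"

lemma modulus_pos: "modulus > 0" and m_dvd_modulus: "m dvd modulus" and n_dvd_modulus: "n dvd modulus"
  using m_nonzero n_nonzero by (auto simp: modulus_def)

lemma turn_add_n: "turn (i + n * k) j = turn i j"
proof (induction k rule: int_shift_induct)
  case (shift k)
  show ?case using turn_shift_n[of "i + n * k" j] by (simp add: algebra_simps)
qed simp

lemma turn_add_m: "turn i (j + m * k) = turn i j"
proof (induction k rule: int_shift_induct)
  case (shift k)
  show ?case using turn_shift_m[of i "j + m * k"] by (simp add: algebra_simps)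
qed simp

lemma turn_mod: "turn (i mod modulus) (j mod modulus) = turn i j"
proof -
  obtain a b where "modulus = n * a" "modulus = m * b"
    using m_dvd_modulus n_dvd_modulus unfolding dvd_def by blast
  then have "i mod modulus = i + n * (- (a * (i div modulus)))"
      "j mod modulus = j + m * (- (b * (j div modulus)))"
    by (metis add_uminus_conv_diff minus_mult_div_eq_mod mult.assoc mult_minus_right)+
  then show ?thesis by (simp only: turn_add_n turn_add_m)
qed

definition factor :: "sym \<Rightarrow> sym \<Rightarrow> quat" where
  "factor s s' = scale_factor (rflag s) *\<^sub>R turn (mark s) (mark s')"

text \<open>\<open>u\<close> is read along the row of g and \<open>w\<close> along the row of g b.
  As a^n b = b a^m, n labels of \<open>u\<close> face m labels of \<open>w\<close>. Division by 3 D
  m n yields: the factor times the mean over \<open>u\<close> is the mean over \<open>w\<close>, up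
  to a difference of carries. The number 3 D clears the denominators of scale and turn, so that
  carries can be integral.\<close>

definition rule :: "(int \<Rightarrow> sym) \<Rightarrow> (int \<Rightarrow> sym) \<Rightarrow> bool" where
  "rule u w \<longleftrightarrow> mark (u 1) = (mark (u 0) + 1) mod modulus \<and> rflag (u 1) = rflag (u 0) \<and>
    direction (u 1) = direction (u 0) \<and> 1 \<le> Re (q1 (direction (u 0) * lab (u 0))) \<and>
    of_int (m * 3 * D) *\<^sub>R (factor (u 0) (w 0) * isum (\<lambda>i. lab (u i)) n) + carry (u 0) =
    of_int (n * 3 * D) *\<^sub>R isum (\<lambda>i. lab (w i)) m + carry (u n)"

text \<open>Floors err by at most 2; in \<open>state_carry\<close> they are weighted by at most 6
  |m| D and 3 |n| D.\<close>

definition carry_bound :: real where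
  "carry_bound = of_int (12 * \<bar>m\<bar> * D + 6 * \<bar>n\<bar> * D)"

text \<open>The bound 16 is 12 + 4: a vector shorter than 12 and two rounding errors.\<close>

definition symbols :: "sym set" where
  "symbols = {s. mark s \<in> {0..<modulus} \<and> direction s \<in> int_quats \<and> norm (direction s) \<le> 1 \<and>
    lab s \<in> int_quats \<and> norm (lab s) \<le> 16 \<and> carry s \<in> int_quats \<and> norm (carry s) \<le> carry_bound}"

lemma finite_symbols: "finite symbols"
proof -
  let ?B = "\<lambda>C. {x \<in> int_quats. norm x \<le> C}"
  have "symbols \<subseteq> (\<lambda>(a, b, c, d, e). Sym a b c d e) `
      ({0..<modulus} \<times> UNIV \<times> ?B 1 \<times> ?B 16 \<times> ?B carry_bound)"
  proof
    fix s assume "s \<in> symbols"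
    then show "s \<in> (\<lambda>(a, b, c, d, e). Sym a b c d e) `
      ({0..<modulus} \<times> UNIV \<times> ?B 1 \<times> ?B 16 \<times> ?B carry_bound)"
      by (intro image_eqI[of _ _ "(mark s, rflag s, direction s, lab s, carry s)"])
        (auto simp: symbols_def)
  qed
  then show ?thesis
    by (rule finite_subset) (intro finite_imageI finite_cartesian_product finite_int_quats_bounded; simp)
qed

section \<open>Growth and drift of the rows of a valid configuration\<close>

definition valid :: "(bs_gen word set \<Rightarrow> sym) \<Rightarrow> bool" where
  "valid y \<longleftrightarrow> (\<forall>g\<in>bs_carrier. y g \<in> symbols \<and>
    rule (\<lambda>i. y (g \<odot> a_pow i)) (\<lambda>i. y (g \<odot> (bs_b \<odot> a_pow i))))"

definition row :: "(bs_gen word set \<Rightarrow> sym) \<Rightarrow> bs_gen word set \<Rightarrow> real \<Rightarrow> quat" where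
  "row y g t = isum (\<lambda>i. lab (y (g \<odot> a_pow i))) \<lfloor>t\<rfloor>"

context
  fixes y assumes y: "valid y"
begin

lemma valid_rule: "g \<in> bs_carrier \<Longrightarrow> rule (\<lambda>i. y (g \<odot> a_pow i)) (\<lambda>i. y (g \<odot> (bs_b \<odot> a_pow i)))"
  and valid_symbols: "g \<in> bs_carrier \<Longrightarrow> y g \<in> symbols"
  using y by (auto simp: valid_def)

lemma norm_lab: "g \<in> bs_carrier \<Longrightarrow> norm (lab (y g)) \<le> 16"
  using valid_symbols by (auto simp: symbols_def)

lemma mark_step: "g \<in> bs_carrier \<Longrightarrow> mark (y (g \<odot> a_pow 1)) = (mark (y g) + 1) mod modulus"
  and rflag_step: "g \<in> bs_carrier \<Longrightarrow> rflag (y (g \<odot> a_pow 1)) = rflag (y g)"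
  and direction_step: "g \<in> bs_carrier \<Longrightarrow> direction (y (g \<odot> a_pow 1)) = direction (y g)"
  and direction_lab: "g \<in> bs_carrier \<Longrightarrow> 1 \<le> Re (q1 (direction (y g) * lab (y g)))"
  using valid_rule[of g] by (simp_all add: rule_def)

lemma mark_mod: "g \<in> bs_carrier \<Longrightarrow> mark (y g) mod modulus = mark (y g)"
  using valid_symbols[of g] by (auto simp: symbols_def)

lemma mark_row:
  assumes "g \<in> bs_carrier"
  shows "mark (y (g \<odot> a_pow i)) = (mark (y g) + i) mod modulus"
proof (induction i rule: int_shift_induct)
  case (shift i)
  let ?M = "\<lambda>i. mark (y (g \<odot> a_pow i))"
  have "?M (i + 1) = (?M i + 1) mod modulus"
    using mark_step[of "g \<odot> a_pow i"] assms by simp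
  then have "?M (i + 1) = (mark (y g) + (i + 1)) mod modulus \<longleftrightarrow>
      (?M i + 1) mod modulus = (mark (y g) + i + 1) mod modulus"
    by (simp add: add.assoc)
  also have "\<dots> \<longleftrightarrow> ?M i mod modulus = (mark (y g) + i) mod modulus"
    by (simp add: mod_eq_dvd_iff)
  also have "?M i mod modulus = ?M i" using mark_mod assms by simp
  finally show ?case by simp
qed (use assms mark_mod in simp)

lemma rflag_row: "g \<in> bs_carrier \<Longrightarrow> rflag (y (g \<odot> a_pow i)) = rflag (y g)"
proof (induction i rule: int_shift_induct)
  case (shift i)
  then show ?case using rflag_step[of "g \<odot> a_pow i"] by auto
qed simp

lemma direction_row: "g \<in> bs_carrier \<Longrightarrow> direction (y (g \<odot> a_pow i)) = direction (y g)"
proof (induction i rule: int_shift_induct)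
  case (shift i)
  then show ?case using direction_step[of "g \<odot> a_pow i"] by auto
qed simp

lemma isum_lipschitz:
  assumes "g \<in> bs_carrier"
  shows "norm (isum (\<lambda>i. lab (y (g \<odot> a_pow i))) k - isum (\<lambda>i. lab (y (g \<odot> a_pow i))) l) \<le> 16 * \<bar>of_int k - of_int l\<bar>"
proof -
  let ?f = "\<lambda>i. lab (y (g \<odot> a_pow i))"
  have "isum ?f k - isum ?f l = isum (\<lambda>i. ?f (l + i)) (k - l)"
    using isum_add[of ?f l "k - l"] by simp
  also have "norm \<dots> \<le> 16 * \<bar>of_int (k - l)\<bar>"
    by (rule norm_isum_le) (use assms norm_lab in auto)
  finally show ?thesis by simp
qed

lemma row_approx:
  assumes "g \<in> bs_carrier"
  shows "norm (row y g t - isum (\<lambda>i. lab (y (g \<odot> a_pow i))) k) \<le> 16 * (\<bar>t - of_int k\<bar> + 1)"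
proof -
  have "\<bar>of_int \<lfloor>t\<rfloor> - of_int k\<bar> \<le> \<bar>t - of_int k\<bar> + (1::real)" by linarith
  then have "16 * \<bar>of_int \<lfloor>t\<rfloor> - of_int k\<bar> \<le> 16 * (\<bar>t - of_int k\<bar> + (1::real))" by simp
  then show ?thesis
    unfolding row_def using isum_lipschitz[OF assms] by (rule order_trans[rotated])
qed

text \<open>\<open>direction\<close> is constant along a row, so every label adds at least 1 to the
  same real part.\<close>

lemma linear_growth_row:
  assumes g: "g \<in> bs_carrier"
  shows "linear_growth (row y g)"
  unfolding linear_growth_def
proof (intro conjI exI allI impI)
  fix t
  show "norm (row y g t) \<le> 16 * \<bar>t\<bar> + 16"
    using row_approx[OF g, of t 0] by simp
next
  fix t :: real assume t: "t \<ge> 0"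
  let ?f = "\<lambda>i. lab (y (g \<odot> a_pow i))"
  have "of_nat k \<le> Re (q1 (direction (y g) * isum ?f (of_nat k)))" for k
  proof (induction k)
    case (Suc k)
    have "direction (y g) * isum ?f (of_nat (Suc k)) =
      direction (y g) * isum ?f (of_nat k) + direction (y g) * ?f (of_nat k)"
      using isum_plus1[of ?f "of_nat k"] by (simp add: add.commute distrib_left)
    moreover have "1 \<le> Re (q1 (direction (y g) * ?f (of_nat k)))"
      using direction_lab[of "g \<odot> a_pow (of_nat k)"] g by (simp add: direction_row)
    ultimately show ?case using Suc by (simp add: plus_quat_def)
  next
    case 0
    have "q1 0 = 0" by (simp add: zero_quat_def)
    then show ?case by simp
  qed
  from this[of "nat \<lfloor>t\<rfloor>"] have "of_int \<lfloor>t\<rfloor> \<le> Re (q1 (direction (y g) * row y g t))"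
    using t by (simp add: row_def)
  also have "\<dots> \<le> norm (direction (y g) * row y g t)"
    using abs_component_le_norm(1) abs_le_D1 by blast
  also have "\<dots> \<le> 1 * norm (row y g t)"
    unfolding norm_mult using valid_symbols[OF g] by (intro mult_right_mono) (auto simp: symbols_def)
  finally show "t - 1 \<le> norm (row y g t)" by linarith
qed

text \<open>Moving the base point by k changes a partial sum only by two boundary blocks of |k|
  labels.\<close>

lemma drift_row_a_pow:
  assumes g: "g \<in> bs_carrier"
  shows "drift (row y g) (row y (g \<odot> a_pow k)) 1 1"
  unfolding drift_def
proof (intro exI allI)
  fix t
  let ?f = "\<lambda>i. lab (y (g \<odot> a_pow i))"
  have "row y (g \<odot> a_pow k) t = isum (\<lambda>i. ?f (k + i)) \<lfloor>t\<rfloor>"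
    using g by (simp add: row_def)
  then have "row y (g \<odot> a_pow k) (1 * t) - 1 *\<^sub>R (1 * row y g t)
      = isum (\<lambda>i. ?f (\<lfloor>t\<rfloor> + i)) k - isum ?f k"
    using isum_add[of ?f k "\<lfloor>t\<rfloor>"] isum_add[of ?f "\<lfloor>t\<rfloor>" k] by (simp add: row_def algebra_simps)
  also have "norm \<dots> \<le> 16 * \<bar>of_int k\<bar> + 16 * \<bar>of_int k\<bar>"
    by (rule norm_triangle_le_diff[OF add_mono]; rule norm_isum_le) (use g norm_lab in auto)
  finally show "norm (row y (g \<odot> a_pow k) (1 * t) - 1 *\<^sub>R (1 * row y g t))
      \<le> 16 * \<bar>of_int k\<bar> + 16 * \<bar>of_int k\<bar>" .
qed

text \<open>Carries telescope over the blocks of n labels. All blocks share one factor, since their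
  positions differ by multiples of n in one row and of m in the other.\<close>

lemma row_sum_rule:
  assumes g: "g \<in> bs_carrier"
  shows "of_int (m * 3 * D) *\<^sub>R (factor (y g) (y (g \<odot> bs_b)) * isum (\<lambda>i. lab (y (g \<odot> a_pow i))) (n * j)) + carry (y g) =
    of_int (n * 3 * D) *\<^sub>R isum (\<lambda>i. lab (y (g \<odot> bs_b \<odot> a_pow i))) (m * j) + carry (y (g \<odot> a_pow (n * j)))"
proof (induction j rule: int_shift_induct)
  case (shift j)
  let ?f = "\<lambda>i. lab (y (g \<odot> a_pow i))" and ?f' = "\<lambda>i. lab (y (g \<odot> bs_b \<odot> a_pow i))"
  let ?q = "factor (y g) (y (g \<odot> bs_b))"
  have eq: "g \<odot> a_pow (n * j) \<odot> (bs_b \<odot> a_pow i) = g \<odot> bs_b \<odot> a_pow (m * j + i)" for i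
  proof -
    have "g \<odot> a_pow (n * j) \<odot> (bs_b \<odot> a_pow i) = g \<odot> (a_pow (n * j) \<odot> bs_b) \<odot> a_pow i"
      using g by (simp add: m_assoc)
    then show ?thesis using g by (simp add: m_assoc a_pow_add flip: b_a_pow)
  qed
  have "factor (y (g \<odot> a_pow (n * j))) (y (g \<odot> bs_b \<odot> a_pow (m * j))) = ?q"
    using g by (simp add: factor_def mark_row rflag_row turn_mod turn_add_m turn_add_n)
  then have step: "of_int (m * 3 * D) *\<^sub>R (?q * isum (\<lambda>i. ?f (n * j + i)) n) + carry (y (g \<odot> a_pow (n * j))) =
    of_int (n * 3 * D) *\<^sub>R isum (\<lambda>i. ?f' (m * j + i)) m + carry (y (g \<odot> a_pow (n * (j + 1))))"
    using valid_rule[of "g \<odot> a_pow (n * j)"] g by (simp add: rule_def eq distrib_left)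
  have sums: "isum ?f (n * (j + 1)) = isum ?f (n * j) + isum (\<lambda>i. ?f (n * j + i)) n"
      "isum ?f' (m * (j + 1)) = isum ?f' (m * j) + isum (\<lambda>i. ?f' (m * j + i)) m"
    using isum_add[of ?f "n * j" n] isum_add[of ?f' "m * j" m] by (simp_all add: distrib_left)
  have add_step: "P + a = Q + b \<longleftrightarrow> (P + p) + a = (Q + q) + c" if "p + b = q + c"
    for P Q p q a b c :: quat
  proof -
    have "(P + p + a) - (Q + q + c) = ((P + a) - (Q + b)) + ((p + b) - (q + c))"
      by (simp add: algebra_simps)
    then have "(P + p + a) - (Q + q + c) = (P + a) - (Q + b)" using that by simp
    then show ?thesis by (metis right_minus_eq)
  qed
  show ?case
    unfolding sums distrib_left[of ?q] scaleR_right_distrib by (rule add_step[OF step])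
qed (use g in simp)

lemma factor_nonzero: "factor s s' \<noteq> 0"
  using norm_turn[of "mark s" "mark s'"] by (auto simp: factor_def scale_factor_def)

text \<open>At block ends the two row sums differ only by carries, and every argument lies within
  one block of such an end. The dilation m/n is the ratio of the facing block lengths.\<close>

lemma drift_row_b:
  assumes g: "g \<in> bs_carrier"
  shows "drift (row y g) (row y (g \<odot> bs_b)) (of_int m / of_int n) (factor (y g) (y (g \<odot> bs_b)))"
  unfolding drift_def
proof (intro exI allI)
  fix t :: real
  let ?q = "factor (y g) (y (g \<odot> bs_b))"
  let ?\<rho> = "of_int m / of_int n :: real"
  let ?f = "\<lambda>i. lab (y (g \<odot> a_pow i))" and ?f' = "\<lambda>i. lab (y (g \<odot> bs_b \<odot> a_pow i))"
  define c where "c = (of_int (n * 3 * D) :: real)"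
  define j where "j = \<lfloor>t / of_int n\<rfloor>"
  have j: "\<bar>t / of_int n - of_int j\<bar> \<le> 1" unfolding j_def by linarith
  have tn: "\<bar>t - of_int (n * j)\<bar> \<le> \<bar>of_int n\<bar>"
  proof -
    have "t - of_int (n * j) = of_int n * (t / of_int n - of_int j)"
      using n_nonzero by (simp add: algebra_simps)
    then show ?thesis using mult_left_mono[OF j, of "\<bar>of_int n\<bar>"] by (simp add: abs_mult)
  qed
  have tm: "\<bar>?\<rho> * t - of_int (m * j)\<bar> \<le> \<bar>of_int m\<bar>"
  proof -
    have "?\<rho> * t - of_int (m * j) = of_int m * (t / of_int n - of_int j)"
      using n_nonzero by (simp add: algebra_simps)
    then show ?thesis using mult_left_mono[OF j, of "\<bar>of_int m\<bar>"] by (simp add: abs_mult)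
  qed
  have swap_sides: "q - p = a - b" if "p + a = q + b" for p q a b :: quat
  proof -
    have "(q - p) - (a - b) = - ((p + a) - (q + b))" by (simp add: algebra_simps)
    also have "\<dots> = 0" using that by simp
    finally show ?thesis by simp
  qed
  have c: "c \<noteq> 0" using n_nonzero D_pos by (simp add: c_def)
  have divide_c: "p = inverse c *\<^sub>R q" if "c *\<^sub>R p = q" for p q :: quat
    using c by (simp flip: that)
  have "of_int (m * 3 * D) = c * ?\<rho>" using n_nonzero by (simp add: c_def)
  then have "c *\<^sub>R (?\<rho> *\<^sub>R (?q * isum ?f (n * j))) + carry (y g) = c *\<^sub>R isum ?f' (m * j) + carry (y (g \<odot> a_pow (n * j)))"
    using row_sum_rule[OF g, of j] by (simp only: c_def scaleR_scaleR)
  then have "c *\<^sub>R (isum ?f' (m * j) - ?\<rho> *\<^sub>R (?q * isum ?f (n * j))) = carry (y g) - carry (y (g \<odot> a_pow (n * j)))"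
    unfolding scaleR_diff_right by (rule swap_sides)
  then have "isum ?f' (m * j) - ?\<rho> *\<^sub>R (?q * isum ?f (n * j)) = inverse c *\<^sub>R (carry (y g) - carry (y (g \<odot> a_pow (n * j))))"
    by (rule divide_c)
  moreover have "norm (carry (y g) - carry (y (g \<odot> a_pow (n * j)))) \<le> carry_bound + carry_bound"
    using g valid_symbols by (intro norm_triangle_le_diff add_mono) (auto simp: symbols_def)
  ultimately have 1: "norm (isum ?f' (m * j) - ?\<rho> *\<^sub>R (?q * isum ?f (n * j))) \<le> inverse \<bar>c\<bar> * (carry_bound + carry_bound)"
    by (simp add: mult_left_mono)
  have 2: "norm (row y (g \<odot> bs_b) (?\<rho> * t) - isum ?f' (m * j)) \<le> 16 * (\<bar>of_int m\<bar> + 1)"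
    using row_approx[of "g \<odot> bs_b" "?\<rho> * t" "m * j"] tm g by fastforce
  have "norm (row y g t - isum ?f (n * j)) \<le> 16 * (\<bar>of_int n\<bar> + 1)"
    using row_approx[of g t "n * j"] tn g by fastforce
  then have 3: "norm (?\<rho> *\<^sub>R (?q * (row y g t - isum ?f (n * j)))) \<le> \<bar>?\<rho>\<bar> * (norm ?q * (16 * (\<bar>of_int n\<bar> + 1)))"
    unfolding norm_scaleR norm_mult by (intro mult_left_mono) auto
  have split: "row y (g \<odot> bs_b) (?\<rho> * t) - ?\<rho> *\<^sub>R (?q * row y g t) =
      (row y (g \<odot> bs_b) (?\<rho> * t) - isum ?f' (m * j)) + (isum ?f' (m * j) - ?\<rho> *\<^sub>R (?q * isum ?f (n * j)))
      - ?\<rho> *\<^sub>R (?q * (row y g t - isum ?f (n * j)))"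
    by (simp add: right_diff_distrib scaleR_diff_right)
  show "norm (row y (g \<odot> bs_b) (?\<rho> * t) - ?\<rho> *\<^sub>R (?q * row y g t))
    \<le> 16 * (\<bar>of_int m\<bar> + 1) + inverse \<bar>c\<bar> * (carry_bound + carry_bound)
      + \<bar>?\<rho>\<bar> * (norm ?q * (16 * (\<bar>of_int n\<bar> + 1)))"
    unfolding split by (intro norm_triangle_le_diff norm_triangle_le add_mono 1 2 3)
qed

end

section \<open>The subshift of finite type given by the rule\<close>

definition alphabet :: "nat set" where "alphabet = {0..<card symbols}"

text \<open>The theorem asks for an alphabet of natural numbers, so the symbols are
  numbered.\<close>

definition decode :: "nat \<Rightarrow> sym" where
  "decode = (SOME h. bij_betw h alphabet symbols)"

lemma bij_decode: "bij_betw decode alphabet symbols"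
  unfolding decode_def alphabet_def using ex_bij_betw_nat_finite[OF finite_symbols] by (rule someI_ex)

definition subshift :: "(bs_gen word set \<Rightarrow> nat) set" where
  "subshift = {x \<in> bs_carrier \<rightarrow>\<^sub>E alphabet. \<forall>g\<in>bs_carrier.
    rule (\<lambda>i. decode (x (g \<odot> a_pow i))) (\<lambda>i. decode (x (g \<odot> (bs_b \<odot> a_pow i))))}"

lemma rule_cong:
  assumes "\<And>i. \<bar>i\<bar> \<le> \<bar>m\<bar> + \<bar>n\<bar> + 1 \<Longrightarrow> u i = u' i \<and> w i = w' i" "rule u w"
  shows "rule u' w'"
proof -
  have "isum (\<lambda>i. lab (u i)) n = isum (\<lambda>i. lab (u' i)) n" "isum (\<lambda>i. lab (w i)) m = isum (\<lambda>i. lab (w' i)) m"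
    by (intro isum_cong; use assms in simp)+
  moreover have "u 0 = u' 0" "u 1 = u' 1" "u n = u' n" "w 0 = w' 0"
    using assms(1)[of 0] assms(1)[of 1] assms(1)[of n] by auto
  ultimately show ?thesis using assms(2) unfolding rule_def by simp
qed

lemma is_SFT_subshift: "is_SFT (BS m n) alphabet subshift"
  unfolding subshift_def
proof (rule is_SFT_local_rule[where R = "\<lambda>c. rule (\<lambda>i. decode (c (a_pow i))) (\<lambda>i. decode (c (bs_b \<odot> a_pow i)))"])
  let ?I = "{- (\<bar>m\<bar> + \<bar>n\<bar> + 1)..\<bar>m\<bar> + \<bar>n\<bar> + 1}"
  let ?P = "a_pow ` ?I \<union> (\<lambda>i. bs_b \<odot> a_pow i) ` ?I"
  show "finite alphabet" by (simp add: alphabet_def)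
  show "finite ?P" by simp
  show "?P \<subseteq> bs_carrier" by auto
  fix c c' :: "bs_gen word set \<Rightarrow> nat"
  assume eq: "\<And>p. p \<in> ?P \<Longrightarrow> c p = c' p"
    and r: "rule (\<lambda>i. decode (c (a_pow i))) (\<lambda>i. decode (c (bs_b \<odot> a_pow i)))"
  show "rule (\<lambda>i. decode (c' (a_pow i))) (\<lambda>i. decode (c' (bs_b \<odot> a_pow i)))"
  proof (rule rule_cong[OF _ r], intro conjI arg_cong[of _ _ decode] eq)
    fix i :: int assume "\<bar>i\<bar> \<le> \<bar>m\<bar> + \<bar>n\<bar> + 1"
    then have "i \<in> ?I" by auto
    then show "a_pow i \<in> ?P" "bs_b \<odot> a_pow i \<in> ?P" by blast+
  qed
qed

lemma subshift_valid:
  assumes "x \<in> subshift"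
  shows "valid (\<lambda>g. decode (x g))"
  using assms bij_betwE[OF bij_decode] unfolding subshift_def valid_def by blast

lemma subshift_extensional: "x \<in> subshift \<Longrightarrow> x \<in> extensional bs_carrier"
  by (auto simp: subshift_def PiE_def)

lemma valid_subshift:
  assumes "valid y"
  shows "(\<lambda>g\<in>bs_carrier. inv_into alphabet decode (y g)) \<in> subshift" (is "?x \<in> _")
proof -
  have inv: "inv_into alphabet decode s \<in> alphabet" "decode (inv_into alphabet decode s) = s"
    if "s \<in> symbols" for s
    using that bij_decode by (auto simp: bij_betw_def inv_into_into f_inv_into_f)
  have "decode (?x g) = y g" if "g \<in> bs_carrier" for g
    using inv assms that by (auto simp: valid_def)
  then show ?thesis
    using assms inv by (auto simp: subshift_def valid_def)
qed

text \<open>The configuration is read off from the right action of the group on pairs \<open>(s, v)\<close>: here \<open>s\<close>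
  is the position in the row and \<open>v\<close> is the average that the row encodes.\<close>

definition up_factor :: "quat \<Rightarrow> real" where
  "up_factor v = (if norm v \<in> {2..<6} then 2 else if norm v \<in> {6..<12} then 1 / 3 else 1)"

definition up :: "real \<times> quat \<Rightarrow> real \<times> quat" where
  "up = (\<lambda>(s, v). (s * of_int m / of_int n,
    up_factor v *\<^sub>R (turn \<lfloor>s\<rfloor> \<lfloor>s * of_int m / of_int n\<rfloor> * v)))"

text \<open>Inverse of the interval exchange in \<open>up_factor\<close>: [4,12) is halved to [2,6)
  and [2,4) is tripled to [6,12). The value 1 elsewhere makes \<open>up\<close> and
  \<open>down\<close> inverse bijections of all states, as \<open>bs_action\<close> demands.\<close>

definition down_factor :: "quat \<Rightarrow> real" where
  "down_factor v = (if norm v \<in> {4..<12} then 1 / 2 else if norm v \<in> {2..<4} then 3 else 1)"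

definition down :: "real \<times> quat \<Rightarrow> real \<times> quat" where
  "down = (\<lambda>(s, v). (s * of_int n / of_int m,
    down_factor v *\<^sub>R (inverse (turn \<lfloor>s * of_int n / of_int m\<rfloor> \<lfloor>s\<rfloor>) * v)))"

lemma turn_nonzero: "turn i j \<noteq> 0"
  using norm_turn[of i j] by auto

lemma norm_up: "norm (snd (up (s, v))) = up_factor v * norm v"
  by (auto simp: up_def norm_mult norm_turn up_factor_def)

lemma norm_down: "norm (snd (down (s, v))) = down_factor v * norm v"
  by (auto simp: down_def norm_mult norm_turn down_factor_def norm_inverse)

lemma down_up: "down (up \<omega>) = \<omega>"
proof -
  obtain s v where \<omega>: "\<omega> = (s, v)" by (cases \<omega>)
  have "down_factor (snd (up (s, v))) * up_factor v = 1"
    unfolding down_factor_def norm_up by (auto simp: up_factor_def)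
  then show ?thesis
    using m_nonzero n_nonzero by (simp add: \<omega> down_def up_def turn_nonzero flip: mult.assoc)
qed

lemma up_down: "up (down \<omega>) = \<omega>"
proof -
  obtain s v where \<omega>: "\<omega> = (s, v)" by (cases \<omega>)
  have "up_factor (snd (down (s, v))) * down_factor v = 1"
    unfolding up_factor_def norm_down by (auto simp: down_factor_def)
  then show ?thesis
    using m_nonzero n_nonzero by (simp add: \<omega> down_def up_def turn_nonzero flip: mult.assoc)
qed

lemma ipow_translation: "ipow (\<lambda>(s, v). (s + 1, v)) (\<lambda>(s, v). (s - 1, v)) k (s, v) = (s + of_int k, v)"
  for s :: real and v :: 'v
proof -
  have "((\<lambda>(s, v). (s + 1, v)) ^^ j) (s, v) = (s + of_nat j, v)"
      "((\<lambda>(s, v). (s - 1, v)) ^^ j) (s, v) = (s - of_nat j, v)" for j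
    by (induction j) auto
  then show ?thesis by (simp add: ipow_def)
qed

lemma state_action:
  obtains act :: "bs_gen word set \<Rightarrow> real \<times> quat \<Rightarrow> real \<times> quat"
  where "\<And>\<omega>. act bs_one \<omega> = \<omega>"
    and "\<And>g h \<omega>. g \<in> bs_carrier \<Longrightarrow> h \<in> bs_carrier \<Longrightarrow> act (g \<odot> h) \<omega> = act h (act g \<omega>)"
    and "\<And>k s v. act (a_pow k) (s, v) = (s + of_int k, v)"
    and "\<And>\<omega>. act bs_b \<omega> = up \<omega>"
    and "\<And>\<omega>. act (bs_inv bs_b) \<omega> = down \<omega>"
proof (rule bs_action[of "\<lambda>(s, v). (s - 1, v)" "\<lambda>(s, v). (s + 1, v)" down up])
  fix \<omega> :: "real \<times> quat"
  obtain s v where \<omega>: "\<omega> = (s, v)" by (cases \<omega>)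
  \<comment> \<open>Advancing s by n advances its image by m, and \<open>turn\<close> notices
    neither shift: this is the defining relation.\<close>
  have "(s + of_int n) * of_int m / of_int n = s * of_int m / of_int n + of_int m"
    using n_nonzero by (simp add: field_simps)
  then show "ipow (\<lambda>(s, v). (s + 1, v)) (\<lambda>(s, v). (s - 1, v)) m (up \<omega>)
      = up (ipow (\<lambda>(s, v). (s + 1, v)) (\<lambda>(s, v). (s - 1, v)) n \<omega>)"
    by (simp add: \<omega> up_def ipow_translation turn_shift_n turn_shift_m)
next
  fix act assume "\<And>\<omega>. act bs_one \<omega> = \<omega>"
    and "\<And>g h \<omega>. g \<in> bs_carrier \<Longrightarrow> h \<in> bs_carrier \<Longrightarrow> act (g \<odot> h) \<omega> = act h (act g \<omega>)"
    and "\<And>k \<omega>. act (a_pow k) \<omega> = ipow (\<lambda>(s, v). (s + 1, v)) (\<lambda>(s, v). (s - 1, v)) k \<omega>"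
    and "\<And>\<omega>. act bs_b \<omega> = up \<omega>"
    and "\<And>\<omega>. act (bs_inv bs_b) \<omega> = down \<omega>"
  then show ?thesis by (intro that[of act]) (simp_all only: ipow_translation)
qed (auto simp: down_up up_down)

section \<open>Labels, directions and carries read off from a state\<close>

lemma int_step: "x + 1 \<le> y \<Longrightarrow> (1::real) \<le> of_int y - of_int x"
  by linarith

lemma floor_step_ge: "1 \<le> c \<Longrightarrow> (1::real) \<le> of_int \<lfloor>(s + 1) * c\<rfloor> - of_int \<lfloor>s * c\<rfloor>" for c s :: real
proof -
  assume "1 \<le> c"
  then have "s * c + 1 \<le> (s + 1) * c" by (simp add: algebra_simps)
  then have "\<lfloor>s * c + 1\<rfloor> \<le> \<lfloor>(s + 1) * c\<rfloor>" by (rule floor_mono)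
  then show ?thesis by (intro int_step) simp
qed

lemma floor_step_le: "c \<le> -1 \<Longrightarrow> (1::real) \<le> of_int \<lfloor>s * c\<rfloor> - of_int \<lfloor>(s + 1) * c\<rfloor>" for c s :: real
proof -
  assume "c \<le> -1"
  then have "(s + 1) * c + 1 \<le> s * c" by (simp add: algebra_simps)
  then have "\<lfloor>(s + 1) * c + 1\<rfloor> \<le> \<lfloor>s * c\<rfloor>" by (rule floor_mono)
  then show ?thesis by (intro int_step) simp
qed

text \<open>The balanced (Beatty) coding of \<open>v\<close>: partial sums telescope and stay at
  bounded distance from the multiples of \<open>v\<close>.\<close>

definition balanced :: "real \<Rightarrow> quat \<Rightarrow> quat" where
  "balanced s v = quat_floor ((s + 1) *\<^sub>R v) - quat_floor (s *\<^sub>R v)"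

text \<open>Some coordinate of a vector of length at least 2 is at least 1 in absolute value, so its
  floors move by at least 1 in every step, always the same way. The direction is the signed basis
  unit which brings this coordinate into the real part.\<close>

lemma direction_exists:
  assumes "2 \<le> norm v"
  shows "\<exists>e\<in>int_quats. norm e \<le> 1 \<and> (\<forall>s. 1 \<le> Re (q1 (e * balanced s v)))"
proof -
  let ?ok = "\<lambda>c f e. \<forall>s::real. e \<in> int_quats \<and> norm e \<le> 1 \<and>
    Re (q1 (e * balanced s v)) = f * (of_int \<lfloor>(s + 1) * c\<rfloor> - of_int \<lfloor>s * c\<rfloor> :: real)"
  have dirs: "?ok (Re (q1 v)) 1 1" "?ok (Re (q1 v)) (-1) (-1)"
    "?ok (Im (q1 v)) 1 (- quat_i)" "?ok (Im (q1 v)) (-1) quat_i"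
    "?ok (Re (q2 v)) 1 (- quat_j)" "?ok (Re (q2 v)) (-1) quat_j"
    "?ok (Im (q2 v)) 1 (- (quat_i * quat_j))" "?ok (Im (q2 v)) (-1) (quat_i * quat_j)"
    by (auto simp: norm_mult intro!: int_quats_minus int_quats_mult)
      (simp_all add: balanced_def quat_floor_def quat_i_def quat_j_def one_quat_def minus_quat_def
        times_quat_def uminus_quat_def scaleR_quat_def)
  have good: ?thesis if c: "\<bar>c\<bar> \<ge> 1" and ok: "?ok c 1 e" "?ok c (-1) e'" for c e e'
  proof (cases "c \<ge> 1")
    case True
    then show ?thesis using ok(1) floor_step_ge[of c] by (intro bexI[of _ e]) auto
  next
    case False
    then have "c \<le> -1" using c by linarith
    then show ?thesis using ok(2) floor_step_le[of c] by (intro bexI[of _ e']) auto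
  qed
  have "\<bar>Re (q1 v)\<bar> \<ge> 1 \<or> \<bar>Im (q1 v)\<bar> \<ge> 1 \<or> \<bar>Re (q2 v)\<bar> \<ge> 1 \<or> \<bar>Im (q2 v)\<bar> \<ge> 1"
  proof (rule ccontr)
    assume "\<not> ?thesis"
    then have "(Re (q1 v))\<^sup>2 < 1" "(Im (q1 v))\<^sup>2 < 1" "(Re (q2 v))\<^sup>2 < 1" "(Im (q2 v))\<^sup>2 < 1"
      by (auto simp: abs_square_less_1)
    then have "(norm v)\<^sup>2 < 4" by (simp add: norm_quat_power2 cmod_power2)
    moreover have "2\<^sup>2 \<le> (norm v)\<^sup>2" using assms by (intro power_mono) auto
    ultimately show False by simp
  qed
  then show ?thesis using good dirs by blast
qed

definition direction_of :: "quat \<Rightarrow> quat" where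
  "direction_of v = (SOME e. e \<in> int_quats \<and> norm e \<le> 1 \<and> (\<forall>s. 1 \<le> Re (q1 (e * balanced s v))))"

lemma direction_of:
  assumes "2 \<le> norm v"
  shows "direction_of v \<in> int_quats" "norm (direction_of v) \<le> 1"
    "1 \<le> Re (q1 (direction_of v * balanced s v))"
  using someI_ex[OF direction_exists[OF assms, unfolded Bex_def]] unfolding direction_of_def by blast+

text \<open>Bracketed so as to show integrality, this is 3 D (m q floor(s v) - n floor(s' v')),
  where (s', v') = up (s, v) and v' = q v. It satisfies the carry equation by telescoping, and it is
  bounded because m q s v = n s' v'.\<close>

definition state_carry :: "real \<times> quat \<Rightarrow> quat" where
  "state_carry = (\<lambda>(s, v). of_int (n * 3 * D) *\<^sub>R - quat_floor (fst (up (s, v)) *\<^sub>R snd (up (s, v))) +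
    (3 * up_factor v) *\<^sub>R (of_int m *\<^sub>R (of_int D *\<^sub>R turn \<lfloor>s\<rfloor> \<lfloor>s * of_int m / of_int n\<rfloor>)
      * quat_floor (s *\<^sub>R v)))"

definition state_symbol :: "real \<times> quat \<Rightarrow> sym" where
  "state_symbol = (\<lambda>(s, v). Sym (\<lfloor>s\<rfloor> mod modulus) (norm v < 6) (direction_of v) (balanced s v)
    (state_carry (s, v)))"

lemma norm_balanced: "norm (balanced s v) \<le> norm v + 4"
proof -
  have "balanced s v = v + (quat_floor ((s + 1) *\<^sub>R v) - (s + 1) *\<^sub>R v) - (quat_floor (s *\<^sub>R v) - s *\<^sub>R v)"
    by (simp add: balanced_def algebra_simps)
  also have "norm \<dots> \<le> norm v + 2 + 2"
    by (intro norm_triangle_le_diff norm_triangle_le add_mono norm_quat_floor_diff order_refl)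
  finally show ?thesis by simp
qed

lemma up_factor_scale:
  assumes "norm v \<in> {2..<12}"
  shows "up_factor v = scale_factor (norm v < 6)"
  using assms by (auto simp: up_factor_def scale_factor_def)

lemma norm_up_range: "norm (snd \<omega>) \<in> {2..<12} \<Longrightarrow> norm (snd (up \<omega>)) \<in> {2..<12}"
  by (cases \<omega>) (auto simp only: norm_up snd_conv, auto simp: up_factor_def)

lemma norm_down_range: "norm (snd \<omega>) \<in> {2..<12} \<Longrightarrow> norm (snd (down \<omega>)) \<in> {2..<12}"
  by (cases \<omega>) (auto simp only: norm_down snd_conv, auto simp: down_factor_def)

lemma state_carry_bounds:
  assumes "norm v \<in> {2..<12}"
  shows "state_carry (s, v) \<in> int_quats" "norm (state_carry (s, v)) \<le> carry_bound"
proof -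
  have 3: "3 * up_factor v \<in> \<int>" "\<bar>3 * up_factor v\<bar> \<le> 6" by (auto simp: up_factor_def)
  show "state_carry (s, v) \<in> int_quats"
    unfolding state_carry_def prod.case
    by (intro int_quats_add int_quats_scaleR int_quats_mult int_quats_minus 3 turn_int) auto
  define q where "q = turn \<lfloor>s\<rfloor> \<lfloor>s * of_int m / of_int n\<rfloor>"
  define w where "w = fst (up (s, v)) *\<^sub>R snd (up (s, v))"
  have w: "of_int (n * 3 * D) *\<^sub>R w = (3 * up_factor v) *\<^sub>R (of_int m *\<^sub>R (of_int D *\<^sub>R q) * (s *\<^sub>R v))"
    using n_nonzero by (simp add: w_def up_def q_def mult_ac)
  have "state_carry (s, v) = of_int (n * 3 * D) *\<^sub>R - (quat_floor w - w)
    + (3 * up_factor v) *\<^sub>R (of_int m *\<^sub>R (of_int D *\<^sub>R q) * (quat_floor (s *\<^sub>R v) - s *\<^sub>R v))"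
    unfolding minus_diff_eq scaleR_diff_right right_diff_distrib w
    by (simp add: state_carry_def flip: q_def w_def)
  also have "norm \<dots> \<le> \<bar>of_int (n * 3 * D)\<bar> * 2 + 6 * (\<bar>of_int m\<bar> * (\<bar>of_int D\<bar> * 1) * 2)"
  proof (intro norm_triangle_le add_mono)
    show "norm (of_int (n * 3 * D) *\<^sub>R - (quat_floor w - w)) \<le> \<bar>of_int (n * 3 * D)\<bar> * 2"
      unfolding norm_scaleR norm_minus_cancel by (intro mult_left_mono norm_quat_floor_diff) simp
    have "norm ((3 * up_factor v) *\<^sub>R (of_int m *\<^sub>R (of_int D *\<^sub>R q) * (quat_floor (s *\<^sub>R v) - s *\<^sub>R v)))
      = \<bar>3 * up_factor v\<bar> * (\<bar>of_int m\<bar> * (\<bar>of_int D\<bar> * 1) * norm (quat_floor (s *\<^sub>R v) - s *\<^sub>R v))"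
      unfolding norm_scaleR norm_mult q_def norm_turn ..
    also have "\<dots> \<le> 6 * (\<bar>of_int m\<bar> * (\<bar>of_int D\<bar> * 1) * 2)"
      by (rule mult_mono[OF 3(2) mult_left_mono[OF norm_quat_floor_diff]]) simp_all
    finally show "norm ((3 * up_factor v) *\<^sub>R (of_int m *\<^sub>R (of_int D *\<^sub>R q) * (quat_floor (s *\<^sub>R v) - s *\<^sub>R v)))
      \<le> 6 * (\<bar>of_int m\<bar> * (\<bar>of_int D\<bar> * 1) * 2)" .
  qed
  also have "\<dots> = carry_bound"
    using D_pos by (simp add: carry_bound_def abs_mult algebra_simps)
  finally show "norm (state_carry (s, v)) \<le> carry_bound" .
qed

lemma state_symbol_in_symbols:
  assumes "norm v \<in> {2..<12}"
  shows "state_symbol (s, v) \<in> symbols"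
  using assms modulus_pos state_carry_bounds[OF assms] direction_of[of v] norm_balanced[of s v]
  by (auto simp: state_symbol_def symbols_def balanced_def)

lemma isum_balanced: "isum (\<lambda>i. balanced (s + of_int i) v) k = quat_floor ((s + of_int k) *\<^sub>R v) - quat_floor (s *\<^sub>R v)"
  using isum_telescope[of "\<lambda>i. balanced (s + of_int i) v" "\<lambda>i. quat_floor ((s + of_int i) *\<^sub>R v)" k]
  by (simp add: balanced_def add_ac)

lemma state_carry_eq: "state_carry (s, v) =
    of_int (n * 3 * D) *\<^sub>R - quat_floor (fst (up (s, v)) *\<^sub>R snd (up (s, v))) +
    of_int (m * 3 * D) *\<^sub>R (up_factor v *\<^sub>R turn \<lfloor>s\<rfloor> \<lfloor>fst (up (s, v))\<rfloor> * quat_floor (s *\<^sub>R v))"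
  by (simp add: state_carry_def up_def mult_ac)

lemma state_rule:
  assumes v: "norm v \<in> {2..<12}" and up: "up (s, v) = (s', v')"
  shows "rule (\<lambda>i. state_symbol (s + of_int i, v)) (\<lambda>i. state_symbol (s' + of_int i, v'))"
proof -
  have s': "s' = s * of_int m / of_int n" and v': "v' = up_factor v *\<^sub>R (turn \<lfloor>s\<rfloor> \<lfloor>s'\<rfloor> * v)"
    using up by (auto simp: up_def)
  define q where "q = turn \<lfloor>s\<rfloor> \<lfloor>s'\<rfloor>"
  have s'_n: "(s + of_int n) * of_int m / of_int n = s' + of_int m"
    using n_nonzero by (simp add: s' field_simps)
  have q_n: "turn \<lfloor>s + of_int n\<rfloor> \<lfloor>s' + of_int m\<rfloor> = q"
    by (simp add: q_def turn_shift_n turn_shift_m)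
  have up_n: "up (s + of_int n, v) = (s' + of_int m, v')"
    unfolding up_def prod.case s'_n q_n by (simp add: v' q_def)
  have "factor (state_symbol (s, v)) (state_symbol (s', v')) = up_factor v *\<^sub>R q"
    using v by (simp add: factor_def state_symbol_def turn_mod up_factor_scale q_def)
  moreover have "isum (\<lambda>i. lab (state_symbol (s + of_int i, v))) n = quat_floor ((s + of_int n) *\<^sub>R v) - quat_floor (s *\<^sub>R v)"
      "isum (\<lambda>i. lab (state_symbol (s' + of_int i, v'))) m = quat_floor ((s' + of_int m) *\<^sub>R v') - quat_floor (s' *\<^sub>R v')"
    by (simp_all add: state_symbol_def isum_balanced)
  moreover have "carry (state_symbol (s, v)) = of_int (n * 3 * D) *\<^sub>R - quat_floor (s' *\<^sub>R v')
      + of_int (m * 3 * D) *\<^sub>R (up_factor v *\<^sub>R q * quat_floor (s *\<^sub>R v))"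
    by (simp add: state_symbol_def state_carry_eq up q_def)
  moreover have "carry (state_symbol (s + of_int n, v)) = of_int (n * 3 * D) *\<^sub>R - quat_floor ((s' + of_int m) *\<^sub>R v')
      + of_int (m * 3 * D) *\<^sub>R (up_factor v *\<^sub>R q * quat_floor ((s + of_int n) *\<^sub>R v))"
    unfolding state_symbol_def prod.case state_carry_eq up_n fst_conv snd_conv q_n by simp
  ultimately show ?thesis
    using v modulus_pos direction_of(3)[of v s]
    by (simp add: rule_def right_diff_distrib scaleR_diff_right)
      (simp add: state_symbol_def mod_simps)
qed

lemma valid_state_symbol:
  assumes act: "\<And>g h \<omega>. g \<in> bs_carrier \<Longrightarrow> h \<in> bs_carrier \<Longrightarrow> act (g \<odot> h) \<omega> = act h (act g \<omega>)"
      "\<And>\<omega>. act bs_one \<omega> = \<omega>"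
      "\<And>k s v. act (a_pow k) (s, v) = (s + of_int k, v)"
      "\<And>\<omega>. act bs_b \<omega> = up \<omega>" "\<And>\<omega>. act (bs_inv bs_b) \<omega> = down \<omega>"
    and \<omega>: "norm (snd \<omega>) \<in> {2..<12}"
  shows "valid (\<lambda>g. state_symbol (act g \<omega>))"
proof -
  have a_pow: "snd (act (a_pow k) \<omega>') = snd \<omega>'" for k \<omega>'
    by (cases \<omega>') (simp add: act)
  have norm: "norm (snd (act g \<omega>)) \<in> {2..<12}" if "g \<in> bs_carrier" for g
    using that
  proof (induction rule: bs_induct)
    case (a g)
    then show ?case using a_pow[of 1] by (simp add: act a_pow_1)
  next
    case (a_inv g)
    then show ?case using a_pow[of "-1"] by (simp add: act a_pow_1 a_pow_minus)
  qed (use \<omega> in \<open>simp_all only: act norm_up_range norm_down_range bs_b_closed inv_closed\<close>)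
  show ?thesis
    unfolding valid_def
  proof
    fix g assume g: "g \<in> bs_carrier"
    obtain s v where sv: "act g \<omega> = (s, v)" by fastforce
    obtain s' v' where up: "up (s, v) = (s', v')" by fastforce
    have v: "norm v \<in> {2..<12}" using norm[OF g] sv by simp
    show "state_symbol (act g \<omega>) \<in> symbols \<and>
      rule (\<lambda>i. state_symbol (act (g \<odot> a_pow i) \<omega>)) (\<lambda>i. state_symbol (act (g \<odot> (bs_b \<odot> a_pow i)) \<omega>))"
      using state_symbol_in_symbols[OF v] state_rule[OF v up] g by (simp add: act sv up)
  qed
qed

lemma subshift_nonempty: "subshift \<noteq> {}"
proof -
  obtain act :: "bs_gen word set \<Rightarrow> real \<times> quat \<Rightarrow> real \<times> quat" where
    "\<And>\<omega>. act bs_one \<omega> = \<omega>"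
    "\<And>g h \<omega>. g \<in> bs_carrier \<Longrightarrow> h \<in> bs_carrier \<Longrightarrow> act (g \<odot> h) \<omega> = act h (act g \<omega>)"
    "\<And>k s v. act (a_pow k) (s, v) = (s + of_int k, v)"
    "\<And>\<omega>. act bs_b \<omega> = up \<omega>" "\<And>\<omega>. act (bs_inv bs_b) \<omega> = down \<omega>"
    by (rule state_action) blast
  then have "valid (\<lambda>g. state_symbol (act g (0, 2)))"
    by (intro valid_state_symbol) simp_all
  then show ?thesis using valid_subshift by blast
qed

end

section \<open>Aperiodicity\<close>

lemma two_power_eq_three_power: "(2::nat) ^ a = 3 ^ c \<Longrightarrow> a = 0 \<and> c = 0"
proof -
  assume eq: "(2::nat) ^ a = 3 ^ c"
  have "odd ((3::nat) ^ c)" by simp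
  then have "a = 0" using eq by (metis even_power even_numeral gr0I)
  then show ?thesis using eq by (cases c) auto
qed

lemma two_powi_three_powi:
  fixes x z :: int
  assumes "(2::real) powi x * (1 / 3) powi z = 1"
  shows "x = 0 \<and> z = 0"
proof -
  have eq: "(2::real) powi x = 3 powi z"
    using assms by (simp add: power_int_divide_distrib field_simps)
  have nat: "a = 0 \<and> c = 0" if "(2::real) ^ a = 3 ^ c" for a c :: nat
  proof -
    have "real (2 ^ a) = real (3 ^ c)" using that by simp
    then show ?thesis using two_power_eq_three_power by (simp only: of_nat_eq_iff)
  qed
  have one: "a = 0 \<and> c = 0" if "(2::real) ^ a * 3 ^ c = 1" for a c :: nat
  proof -
    have "real (2 ^ a * 3 ^ c) = real 1" using that by simp
    then have "(2::nat) ^ a * 3 ^ c = 1" by (simp only: of_nat_eq_iff)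
    then show ?thesis by simp
  qed
  obtain a c where ac: "x = int a \<or> x = - int a" "z = int c \<or> z = - int c"
    by (metis int_cases2)
  then show ?thesis
    using eq nat[of a c] one[of a c] by (auto simp: power_int_minus field_simps)
qed

text \<open>If d 0 were nonzero, |d j| would decrease strictly and, as q is nonzero, never reach
  0.\<close>

lemma int_descent:
  fixes d :: "nat \<Rightarrow> int"
  assumes "\<And>j. p * d (Suc j) = q * d j" "\<bar>q\<bar> < \<bar>p\<bar>" "q \<noteq> 0"
  shows "d 0 = 0"
proof (rule ccontr)
  assume d0: "d 0 \<noteq> 0"
  have "d j \<noteq> 0 \<and> nat \<bar>d j\<bar> + j \<le> nat \<bar>d 0\<bar>" for j
  proof (induction j)
    case (Suc j)
    have eq: "\<bar>p\<bar> * \<bar>d (Suc j)\<bar> = \<bar>q\<bar> * \<bar>d j\<bar>"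
      using assms(1)[of j] by (metis abs_mult)
    have "\<bar>p\<bar> * \<bar>d (Suc j)\<bar> < \<bar>p\<bar> * \<bar>d j\<bar>"
      unfolding eq using assms(2) Suc by (intro mult_strict_right_mono) auto
    then have "\<bar>d (Suc j)\<bar> < \<bar>d j\<bar>" by (simp add: mult_less_cancel_left)
    moreover have "d (Suc j) \<noteq> 0" using assms(1)[of j] assms(3) Suc by auto
    ultimately show ?case using Suc by linarith
  qed (use d0 in simp)
  from this[of "Suc (nat \<bar>d 0\<bar>)"] show False by linarith
qed

context multiplier begin

text \<open>Of the j edges, x double the length and z divide it by 3.\<close>

lemma drift_b_pow:
  assumes y: "valid y" and g: "g \<in> bs_carrier"
  shows "\<exists>\<rho> q. drift (row y g) (row y (g \<odot> bs_b [^]\<^bsub>BS m n\<^esub> j)) \<rho> q \<and> \<rho> \<noteq> 0 \<and>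
    (\<exists>x z::nat. x + z = j \<and> norm q = 2 ^ x * (1 / 3) ^ z)"
proof (induction j)
  case 0
  show ?case
    using g drift_refl[of "row y g"] by (intro exI[of _ "1::real"] exI[of _ "1::quat"]) auto
next
  case (Suc j)
  let ?h = "g \<odot> bs_b [^]\<^bsub>BS m n\<^esub> j"
  obtain \<rho> q x z where *: "drift (row y g) (row y ?h) \<rho> q" "\<rho> \<noteq> 0" "x + z = j" "norm q = 2 ^ x * (1 / 3) ^ z"
    using Suc by blast
  let ?f = "factor (y ?h) (y (?h \<odot> bs_b))"
  have h: "?h \<in> bs_carrier" using g by simp
  have "drift (row y g) (row y (?h \<odot> bs_b)) (of_int m / of_int n * \<rho>) (?f * q)"
    by (rule drift_trans[OF *(1) drift_row_b[OF y h]])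
  moreover have "?h \<odot> bs_b = g \<odot> bs_b [^]\<^bsub>BS m n\<^esub> Suc j" using g by (simp add: m_assoc)
  moreover have "\<exists>x z. x + z = Suc j \<and> norm (?f * q) = 2 ^ x * (1 / 3) ^ z"
  proof (cases "rflag (y ?h)")
    case True
    then have "norm (?f * q) = 2 ^ Suc x * (1 / 3) ^ z"
      by (simp add: norm_mult *(4) factor_def scale_factor_def norm_turn)
    then show ?thesis using *(3) by (intro exI[of _ "Suc x"] exI[of _ z]) simp
  next
    case False
    then have "norm (?f * q) = 2 ^ x * (1 / 3) ^ Suc z"
      by (simp add: norm_mult *(4) factor_def scale_factor_def norm_turn)
    then show ?thesis using *(3) by (intro exI[of _ x] exI[of _ "Suc z"]) simp
  qed
  moreover have "of_int m / of_int n * \<rho> \<noteq> 0" using * m_nonzero n_nonzero by simp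
  ultimately show ?case by (intro exI[of _ "of_int m / of_int n * \<rho>"] exI[of _ "?f * q"]) simp
qed

text \<open>Equal rows would give a self-drift whose factor has norm 2^x 3^-z with x + z = j > 0,
  and this norm would have to be 1.\<close>

lemma rows_b_pow_distinct:
  assumes y: "valid y" and g: "g \<in> bs_carrier" and j: "j > (0::nat)"
  shows "row y (g \<odot> bs_b [^]\<^bsub>BS m n\<^esub> j) \<noteq> row y g"
proof
  assume eq: "row y (g \<odot> bs_b [^]\<^bsub>BS m n\<^esub> j) = row y g"
  obtain \<rho> q and x z :: nat where *: "drift (row y g) (row y g) \<rho> q" "\<rho> \<noteq> 0" "x + z = j" "norm q = 2 ^ x * (1 / 3) ^ z"
    using drift_b_pow[OF y g, of j] unfolding eq by blast
  have "q \<noteq> 0" using *(4) by (metis divide_eq_0_iff mult_eq_0_iff norm_zero power_not_zero zero_neq_numeral zero_neq_one)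
  then have "norm q = 1" using drift_self_norm[OF linear_growth_row[OF y g] *(1,2)] by blast
  then have "(2::real) powi int x * (1 / 3) powi int z = 1" using *(4) by simp
  then have "x = 0 \<and> z = 0" using two_powi_three_powi by fastforce
  then show False using *(3) j by simp
qed

lemma row_cong: "(\<And>i. y (g \<odot> a_pow i) = y (h \<odot> a_pow i)) \<Longrightarrow> row y g = row y h"
  by (simp add: row_def fun_eq_iff)

lemma weakly_aperiodic_subshift: "weakly_aperiodic (BS m n) subshift"
  unfolding weakly_aperiodic_def
proof (intro conjI ballI notI)
  show "False" if "subshift = {}" using that subshift_nonempty by blast
next
  fix x assume x: "x \<in> subshift" and "strongly_periodic (BS m n) x"
  then obtain d :: nat where d: "d > 0" "\<And>h. h \<in> bs_carrier \<Longrightarrow> x (bs_b [^]\<^bsub>BS m n\<^esub> d \<odot> h) = x h"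
    using strongly_periodic_pow[OF _ bs_b_closed] by blast
  have "row (\<lambda>g. decode (x g)) (bs_one \<odot> bs_b [^]\<^bsub>BS m n\<^esub> d) = row (\<lambda>g. decode (x g)) bs_one"
    using d(2) by (intro row_cong) simp
  then show False using rows_b_pow_distinct[OF subshift_valid[OF x] one_closed d(1)] by simp
qed

end

section \<open>Exponents of a, detected by an affine action\<close>

context baumslag_solitar begin

lemma trivial_multiplier: "multiplier m n (\<lambda>_ _. 1) 1"
  by unfold_locales auto

text \<open>The classical affine representation: a translates by 1 and b dilates by m/n. It
  distinguishes the powers of a.\<close>

lemma affine_action:
  obtains act :: "bs_gen word set \<Rightarrow> real \<Rightarrow> real"
  where "\<And>\<omega>. act bs_one \<omega> = \<omega>"
    and "\<And>g h \<omega>. g \<in> bs_carrier \<Longrightarrow> h \<in> bs_carrier \<Longrightarrow> act (g \<odot> h) \<omega> = act h (act g \<omega>)"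
    and "\<And>k s. act (a_pow k) s = s + of_int k"
    and "\<And>s. act bs_b s = s * of_int m / of_int n"
proof -
  have pow: "ipow (\<lambda>s. s + 1) (\<lambda>s. s - 1) k s = s + of_int k" for k and s :: real
  proof -
    have "((\<lambda>s. s + 1) ^^ j) s = s + of_nat j" "((\<lambda>s. s - 1) ^^ j) s = s - of_nat j" for j
      by (induction j) auto
    then show ?thesis by (simp add: ipow_def)
  qed
  show ?thesis
  proof (rule bs_action[of "\<lambda>s. s - 1" "\<lambda>s. s + 1" "\<lambda>s. s * of_int n / of_int m" "\<lambda>s. s * of_int m / of_int n"])
    fix act :: "bs_gen word set \<Rightarrow> real \<Rightarrow> real"
    assume "\<And>\<omega>. act bs_one \<omega> = \<omega>"
      and "\<And>g h \<omega>. g \<in> bs_carrier \<Longrightarrow> h \<in> bs_carrier \<Longrightarrow> act (g \<odot> h) \<omega> = act h (act g \<omega>)"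
      and "\<And>k \<omega>. act (a_pow k) \<omega> = ipow (\<lambda>s. s + 1) (\<lambda>s. s - 1) k \<omega>"
      and "\<And>\<omega>. act bs_b \<omega> = \<omega> * of_int m / of_int n"
    then show ?thesis by (intro that[of act]) (simp_all only: pow)
  qed (use m_nonzero n_nonzero in \<open>simp_all add: pow field_simps\<close>)
qed

lemma a_pow_inj: "a_pow k = a_pow l \<longleftrightarrow> k = l"
proof -
  obtain act :: "bs_gen word set \<Rightarrow> real \<Rightarrow> real" where "\<And>k s. act (a_pow k) s = s + of_int k"
    by (rule affine_action) blast
  then show ?thesis by (metis add_left_cancel of_int_eq_iff)
qed

lemma a_pow_b_commute:
  assumes "a_pow k \<odot> bs_b = bs_b \<odot> a_pow l"
  shows "n * l = m * k"
proof -
  obtain act :: "bs_gen word set \<Rightarrow> real \<Rightarrow> real" where act: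
    "\<And>g h \<omega>. g \<in> bs_carrier \<Longrightarrow> h \<in> bs_carrier \<Longrightarrow> act (g \<odot> h) \<omega> = act h (act g \<omega>)"
    "\<And>k s. act (a_pow k) s = s + of_int k" "\<And>s. act bs_b s = s * of_int m / of_int n"
    by (rule affine_action) blast
  have "act (a_pow k \<odot> bs_b) 0 = act (bs_b \<odot> a_pow l) 0" using assms by simp
  then have "of_int k * of_int m / of_int n = (of_int l :: real)" by (simp add: act)
  then have "(of_int (n * l) :: real) = of_int (m * k)" using n_nonzero by (simp add: field_simps)
  then show ?thesis by (simp only: of_int_eq_iff)
qed

lemma a_pow_b_sgn_commute:
  assumes "a_pow k \<odot> b_sgn e = b_sgn e \<odot> a_pow l"
  shows "(if e then n else m) * l = (if e then m else n) * k"
proof (cases e)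
  case True
  then show ?thesis using a_pow_b_commute[of k l] assms by (simp add: b_sgn_def)
next
  case False
  then have "bs_b \<odot> (a_pow k \<odot> bs_inv bs_b) \<odot> bs_b = bs_b \<odot> (bs_inv bs_b \<odot> a_pow l) \<odot> bs_b"
    using assms by (simp add: b_sgn_def)
  then have "a_pow l \<odot> bs_b = bs_b \<odot> a_pow k"
    by (simp add: m_assoc) (simp add: m_assoc[symmetric])
  then show ?thesis using a_pow_b_commute[of l k] False by simp
qed

text \<open>The exponents of the conjugates by powers of \<open>b\<close> shrink by the factor \<open>|m/n|\<close> or \<open>|n/m|\<close>.\<close>

lemma conjugate_exponents_descent:
  assumes ne: "\<bar>m\<bar> \<noteq> \<bar>n\<bar>"
    and h: "\<And>e j. \<exists>k. h \<odot> b_sgn e [^]\<^bsub>BS m n\<^esub> (j::nat) = b_sgn e [^]\<^bsub>BS m n\<^esub> j \<odot> a_pow k"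
    and hc: "h \<in> bs_carrier"
  shows "h = bs_one"
proof -
  obtain e where e: "\<bar>if e then m else n\<bar> < \<bar>if e then n else m\<bar>"
    using ne by (metis linorder_neqE)
  obtain d where d: "\<And>j::nat. h \<odot> b_sgn e [^]\<^bsub>BS m n\<^esub> j = b_sgn e [^]\<^bsub>BS m n\<^esub> j \<odot> a_pow (d j)"
    using h by metis
  have "(if e then n else m) * d (Suc j) = (if e then m else n) * d j" for j
  proof (rule a_pow_b_sgn_commute)
    have "b_sgn e [^]\<^bsub>BS m n\<^esub> j \<odot> (a_pow (d j) \<odot> b_sgn e) = h \<odot> b_sgn e [^]\<^bsub>BS m n\<^esub> j \<odot> b_sgn e"
      by (simp add: d m_assoc)
    also have "\<dots> = h \<odot> b_sgn e [^]\<^bsub>BS m n\<^esub> Suc j" using hc by (simp add: m_assoc)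
    also have "\<dots> = b_sgn e [^]\<^bsub>BS m n\<^esub> j \<odot> (b_sgn e \<odot> a_pow (d (Suc j)))"
      unfolding d by (simp add: m_assoc)
    finally show "a_pow (d j) \<odot> b_sgn e = b_sgn e \<odot> a_pow (d (Suc j))" by simp
  qed
  then have "d 0 = 0"
    by (rule int_descent[OF _ e]) (use m_nonzero n_nonzero in auto)
  then show ?thesis using d[of 0] hc by simp
qed

end

section \<open>The strongly aperiodic subshift\<close>

context baumslag_solitar begin

text \<open>In the average of a row, passing a \<open>b\<close>-edge which leaves at the residue \<open>i\<close> and arrives at the
  residue \<open>j\<close> is multiplication by \<open>U\<^sup>-\<^sup>j V U\<^sup>i\<close>. Along a reduced path the inner powers of
  \<open>U\<close> between \<open>V\<close> and \<open>V\<^sup>-\<^sup>1\<close> do not vanish.\<close>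

definition edge_turn :: "int \<Rightarrow> int \<Rightarrow> quat" where
  "edge_turn i j = roti (- (j mod \<bar>m\<bar>)) * rot quat_j True * roti (i mod \<bar>n\<bar>)"

lemma mod_add_self_abs: "(i + k) mod \<bar>k\<bar> = i mod \<bar>k\<bar>" for i k :: int
  by (simp add: mod_eq_dvd_iff)

text \<open>The product has at most |m| + 1 + |n| letters, each with denominator 5.\<close>

lemma edge_multiplier: "multiplier m n edge_turn (5 ^ (nat \<bar>m\<bar> + 1 + nat \<bar>n\<bar>))"
proof unfold_locales
  fix i j
  show "norm (edge_turn i j) = 1"
    by (simp add: edge_turn_def norm_mult norm_rot)
  show "edge_turn (i + n) j = edge_turn i j" "edge_turn i (j + m) = edge_turn i j"
    by (simp_all add: edge_turn_def mod_add_self_abs)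
  have "0 \<le> j mod \<bar>m\<bar>" "j mod \<bar>m\<bar> < \<bar>m\<bar>" "0 \<le> i mod \<bar>n\<bar>" "i mod \<bar>n\<bar> < \<bar>n\<bar>"
    using m_nonzero n_nonzero by simp_all
  then have "\<bar>- (j mod \<bar>m\<bar>)\<bar> \<le> int (nat \<bar>m\<bar>)" "\<bar>i mod \<bar>n\<bar>\<bar> \<le> int (nat \<bar>n\<bar>)"
    by linarith+
  then have "(5 ^ nat \<bar>m\<bar> *\<^sub>R roti (- (j mod \<bar>m\<bar>))) * (5 *\<^sub>R rot quat_j True) * (5 ^ nat \<bar>n\<bar> *\<^sub>R roti (i mod \<bar>n\<bar>)) \<in> int_quats"
    by (intro int_quats_mult roti_int rot_int) auto
  then show "of_int (5 ^ (nat \<bar>m\<bar> + 1 + nat \<bar>n\<bar>)) *\<^sub>R edge_turn i j \<in> int_quats"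
    by (simp add: edge_turn_def power_add mult_ac mult.assoc)
qed simp

end

text \<open>A locale of its own, because \<open>baumslag_solitar\<close> is also combined with
  constant turns.\<close>

locale edge_subshift = baumslag_solitar

sublocale edge_subshift \<subseteq> multiplier m n edge_turn "5 ^ (nat \<bar>m\<bar> + 1 + nat \<bar>n\<bar>)"
  by (rule edge_multiplier)

context edge_subshift begin

text \<open>An edge b leaves at a residue modulo |n| and arrives at one modulo |m|; for b^-1 it is
  the other way round. Hence arrival is counted modulo
  \<open>exit_modulus (\<not> e)\<close>.\<close>

definition exit_modulus :: "bool \<Rightarrow> int" where
  "exit_modulus e = (if e then \<bar>n\<bar> else \<bar>m\<bar>)"

text \<open>The exponents of 2 and 1/3 are kept apart. In the drifts below, x + z is the exponent of
  b along the path, so that x and z also determine the dilation (m/n)^(x+z).\<close>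

definition log_scale :: "int \<Rightarrow> int \<Rightarrow> real" where
  "log_scale x z = 2 powi x * (1 / 3) powi z"

lemma log_scale_pos: "log_scale x z > 0"
  by (simp add: log_scale_def)

lemma log_scale_mult: "log_scale x z * log_scale x' z' = log_scale (x + x') (z + z')"
  by (simp add: log_scale_def power_int_add)

lemma log_scale_inverse: "inverse (log_scale x z) = log_scale (- x) (- z)"
  by (simp add: log_scale_def power_int_minus)

lemma scale_factor_log: "scale_factor r = log_scale (if r then 1 else 0) (if r then 0 else 1)"
  by (simp add: scale_factor_def log_scale_def)

text \<open>The inverse of U^-j V U^i is U^-i V^-1 U^j, so a backward edge has the same shape as a
  forward one, with V inverted.\<close>

lemma drift_edge:
  fixes e :: bool
  assumes y: "valid y" and g: "g \<in> bs_carrier"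
  defines "h \<equiv> g \<odot> b_sgn e"
  shows "\<exists>x z. x + z = (if e then 1 else - 1) \<and>
    drift (row y g) (row y h) ((of_int m / of_int n) powi (x + z))
      (log_scale x z *\<^sub>R (roti (- (mark (y h) mod exit_modulus (\<not> e))) * rot quat_j e * roti (mark (y g) mod exit_modulus e)))"
proof (cases e)
  case True
  let ?x = "if rflag (y g) then 1 else 0 :: int" and ?z = "if rflag (y g) then 0 else 1 :: int"
  have h: "h = g \<odot> bs_b" using True by (simp add: h_def b_sgn_def)
  show ?thesis
  proof (intro exI conjI)
    show sum: "?x + ?z = (if e then 1 else - 1)" using True by simp
    show "drift (row y g) (row y h) ((of_int m / of_int n) powi (?x + ?z)) (log_scale ?x ?z *\<^sub>R
        (roti (- (mark (y h) mod exit_modulus (\<not> e))) * rot quat_j e * roti (mark (y g) mod exit_modulus e)))"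
      using drift_row_b[OF y g] True unfolding sum
      by (simp add: h factor_def scale_factor_log edge_turn_def exit_modulus_def)
  qed
next
  case False
  then have h: "h = g \<odot> bs_inv bs_b" by (simp add: h_def b_sgn_def)
  then have hg: "h \<in> bs_carrier" "h \<odot> bs_b = g" using g by (simp_all add: m_assoc)
  let ?x = "if rflag (y h) then 1 else 0 :: int" and ?z = "if rflag (y h) then 0 else 1 :: int"
  have "drift (row y g) (row y h) (inverse (of_int m / of_int n)) (inverse (factor (y h) (y g)))"
    using drift_inverse[OF drift_row_b[OF y hg(1)]] m_nonzero n_nonzero factor_nonzero[OF y]
    unfolding hg(2) by simp
  moreover have "inverse (factor (y h) (y g)) = log_scale (- ?x) (- ?z) *\<^sub>R
      (roti (- (mark (y h) mod exit_modulus (\<not> e))) * rot quat_j e * roti (mark (y g) mod exit_modulus e))"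
  proof -
    have nz: "roti k \<noteq> 0" for k using norm_roti[of k] by (metis norm_zero zero_neq_one)
    have "rot quat_j True \<noteq> 0" by (simp add: rot_nonzero)
    then have "inverse (edge_turn (mark (y h)) (mark (y g))) =
      roti (- (mark (y h) mod \<bar>n\<bar>)) * (rot quat_j False * roti (mark (y g) mod \<bar>m\<bar>))"
      by (simp add: edge_turn_def nonzero_inverse_mult_distrib nz inverse_roti inverse_rot)
    then show ?thesis
      using False
      by (simp add: factor_def scale_factor_log nonzero_inverse_scaleR_distrib log_scale_inverse
          exit_modulus_def mult.assoc turn_nonzero log_scale_pos[THEN less_imp_neq, symmetric] flip: log_scale_inverse)
  qed
  moreover have "inverse (of_int m / of_int n :: real) = (of_int m / of_int n) powi (- ?x + - ?z)"
    by (simp add: power_int_minus)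
  ultimately show ?thesis
    using False by (intro exI[of _ "- ?x"] exI[of _ "- ?z"]) simp
qed

text \<open>U raised to the arrival residue undoes the leftmost power of U in \<open>W\<close> and
  exposes the letter V or V^-1 of the last edge. With this invariant the path spells a reduced
  word.\<close>

lemma drift_reduced:
  assumes y: "valid y" and k: "k \<in> bs_carrier" and g: "reduced g s"
  shows "\<exists>x z W. drift (row y k) (row y (k \<odot> g)) ((of_int m / of_int n) powi (x + z)) (log_scale x z *\<^sub>R W) \<and>
    norm W = 1 \<and> (case s of None \<Rightarrow> W = 1
      | Some e \<Rightarrow> rot_state quat_j e (roti (mark (y (k \<odot> g)) mod exit_modulus (\<not> e)) * W))"
  using g
proof induction
  case reduced_one
  show ?case
    using drift_refl[of "row y k"] k
    by (intro exI[of _ "0::int"] exI[of _ "1::quat"]) (simp add: log_scale_def)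
next
  case (reduced_step g s e i)
  have g: "g \<in> bs_carrier" using reduced_step(1) by (rule reduced_closed)
  obtain x z W where W: "drift (row y k) (row y (k \<odot> g)) ((of_int m / of_int n) powi (x + z)) (log_scale x z *\<^sub>R W)"
    "norm W = 1" "case s of None \<Rightarrow> W = 1
      | Some e \<Rightarrow> rot_state quat_j e (roti (mark (y (k \<odot> g)) mod exit_modulus (\<not> e)) * W)"
    using reduced_step.IH by blast
  define g' where "g' = k \<odot> g \<odot> a_pow i"
  define h where "h = g' \<odot> b_sgn e"
  have g': "g' \<in> bs_carrier" using k g by (simp add: g'_def)
  have h: "h = k \<odot> (g \<odot> a_pow i \<odot> b_sgn e)" using k g by (simp add: h_def g'_def m_assoc)
  let ?\<mu> = "mark (y (k \<odot> g))" and ?\<mu>' = "mark (y g')"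
  have mark: "?\<mu>' = (?\<mu> + i) mod modulus" using mark_row[OF y] k g by (simp add: g'_def)
  obtain x' z' where xz': "x' + z' = (if e then 1 else - 1)"
    "drift (row y g') (row y h) ((of_int m / of_int n) powi (x' + z'))
      (log_scale x' z' *\<^sub>R (roti (- (mark (y h) mod exit_modulus (\<not> e))) * rot quat_j e * roti (?\<mu>' mod exit_modulus e)))"
    using drift_edge[OF y g', of e] unfolding h_def by blast
  define W' where "W' = roti (- (mark (y h) mod exit_modulus (\<not> e))) * rot quat_j e * roti (?\<mu>' mod exit_modulus e) * W"
  have "drift (row y k) (row y g') ((of_int m / of_int n) powi (x + z)) (log_scale x z *\<^sub>R W)"
    using drift_trans[OF W(1) drift_row_a_pow[OF y, of "k \<odot> g" i]] k g by (simp add: g'_def)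
  from drift_trans[OF this xz'(2)]
  have "drift (row y k) (row y h) ((of_int m / of_int n) powi (x' + x + (z' + z))) (log_scale (x' + x) (z' + z) *\<^sub>R W')"
    using m_nonzero n_nonzero
    by (simp add: W'_def power_int_add mult_ac flip: log_scale_mult)
  moreover have "norm W' = 1"
    by (simp add: W'_def norm_mult W(2) norm_rot)
  moreover have "rot_state quat_j e (roti (mark (y h) mod exit_modulus (\<not> e)) * W')"
  proof -
    have "roti (mark (y h) mod exit_modulus (\<not> e)) * W' = rot quat_j e * (roti (?\<mu>' mod exit_modulus e) * W)"
      by (simp add: W'_def mult.assoc[symmetric] flip: roti_add)
    moreover have "rot_state quat_j e (rot quat_j e * (roti (?\<mu>' mod exit_modulus e) * W))"
    proof (cases s)
      case None
      then show ?thesis using W(3) rot_state_j_roti_1 by simp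
    next
      case (Some e')
      \<comment> \<open>The exponent of U between two consecutive letters V or V^-1: the departure
        residue minus the preceding arrival residue.\<close>
      let ?k = "?\<mu>' mod exit_modulus e - ?\<mu> mod exit_modulus (\<not> e')"
      have st: "rot_state quat_j e' (roti (?\<mu> mod exit_modulus (\<not> e')) * W)" using W(3) Some by simp
      \<comment> \<open>For opposite signs both residues have the same modulus; their equality would
        be a pinch, which \<open>reduced\<close> excludes.\<close>
      have "?k = 0 \<Longrightarrow> e' = e"
      proof (rule ccontr)
        assume k0: "?k = 0" and ne: "e' \<noteq> e"
        then have e': "e' = (\<not> e)" by auto
        have dvd: "exit_modulus e dvd modulus" using m_dvd_modulus n_dvd_modulus by (simp add: exit_modulus_def)
        have "(?\<mu> + i) mod exit_modulus e = ?\<mu> mod exit_modulus e"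
          using k0 dvd by (simp add: mark e' mod_mod_cancel)
        then have "exit_modulus e dvd i" by (simp add: mod_eq_dvd_iff)
        then have "(if e then n else m) dvd i" by (auto simp: exit_modulus_def split: if_splits)
        then show False using reduced_step(2) Some e' by simp
      qed
      then have "rot_state quat_j e (rot quat_j e * (roti ?k * (roti (?\<mu> mod exit_modulus (\<not> e')) * W)))"
        by (rule rot_state_j_roti[OF st])
      then show ?thesis by (simp flip: mult.assoc roti_add)
    qed
    ultimately show ?thesis by simp
  qed
  ultimately show ?case
    by (intro exI[of _ "x' + x"] exI[of _ "z' + z"] exI[of _ W']) (simp flip: h)
qed

text \<open>The factor of a self-drift has norm 1, which kills both exponents of
  \<open>log_scale\<close>. Then the dilation is 1 too and the factor is just \<open>W\<close>; now
  W = 1 leaves only a path without b-edges.\<close>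

lemma row_period_in_a:
  assumes y: "valid y" and k: "k \<in> bs_carrier" and w: "w \<in> bs_carrier"
    and eq: "\<And>i. y (k \<odot> w \<odot> a_pow i) = y (k \<odot> a_pow i)"
  shows "\<exists>i. w = a_pow i"
proof -
  obtain g s i where g: "reduced g s" "w = g \<odot> a_pow i" using w by (rule reduced_exists)
  have gc: "g \<in> bs_carrier" using g(1) by (rule reduced_closed)
  obtain x z W where W: "drift (row y k) (row y (k \<odot> g)) ((of_int m / of_int n) powi (x + z)) (log_scale x z *\<^sub>R W)"
    "norm W = 1" "case s of None \<Rightarrow> W = 1
      | Some e \<Rightarrow> rot_state quat_j e (roti (mark (y (k \<odot> g)) mod exit_modulus (\<not> e)) * W)"
    using drift_reduced[OF y k g(1)] by blast
  have "row y (k \<odot> g \<odot> a_pow i) = row y k"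
    using eq k gc by (intro row_cong) (simp add: g(2) m_assoc)
  then have d: "drift (row y k) (row y k) ((of_int m / of_int n) powi (x + z)) (log_scale x z *\<^sub>R W)"
    using drift_trans[OF W(1) drift_row_a_pow[OF y, of "k \<odot> g" i]] k gc by simp
  have grow: "linear_growth (row y k)" by (rule linear_growth_row[OF y k])
  have "W \<noteq> 0" using W(2) by auto
  then have "norm (log_scale x z *\<^sub>R W) = 1"
    using m_nonzero n_nonzero log_scale_pos[of x z] by (intro drift_self_norm[OF grow d]) auto
  then have "log_scale x z = 1" using W(2) log_scale_pos[of x z] by simp
  moreover from this have "x = 0 \<and> z = 0" unfolding log_scale_def by (rule two_powi_three_powi)
  ultimately have "W = 1" using d drift_self_eq_1[OF grow] by simp
  have "s = None"
  proof (cases s)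
    case (Some e)
    then show ?thesis using W(3) rot_state_roti_ne_1 \<open>W = 1\<close> by (simp only: option.case) blast
  qed
  then have "g = bs_one" using g(1) by (auto elim: reduced.cases)
  then show ?thesis using g(2) by auto
qed

lemma strongly_aperiodic_subshift: "strongly_aperiodic (BS m n) subshift"
  unfolding strongly_aperiodic_def
proof (intro conjI ballI notI)
  show "False" if "subshift = {}" using that subshift_nonempty by blast
next
  fix x assume x: "x \<in> subshift" and "weakly_periodic (BS m n) x"
  then obtain h where h: "h \<in> bs_carrier" "h \<noteq> bs_one" "\<And>g. g \<in> bs_carrier \<Longrightarrow> x (h \<odot> g) = x g"
    using weakly_periodic_iff[OF subshift_extensional[OF x]] by blast
  define y where "y g = decode (x g)" for g
  have y: "valid y" unfolding y_def by (rule subshift_valid[OF x])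
  have yh: "y (h \<odot> g) = y g" if "g \<in> bs_carrier" for g using h(3)[OF that] by (simp add: y_def)
  have conj: "\<exists>i. h \<odot> k = k \<odot> a_pow i" if k: "k \<in> bs_carrier" for k
  proof -
    \<comment> \<open>Seen from \<open>k\<close>, the left period \<open>h\<close> is right
      multiplication by its conjugate.\<close>
    let ?w = "bs_inv k \<odot> (h \<odot> k)"
    have kw: "k \<odot> ?w = h \<odot> k" using k h(1) by (simp flip: m_assoc)
    have "\<exists>i. ?w = a_pow i"
    proof (rule row_period_in_a[OF y k])
      show "y (k \<odot> ?w \<odot> a_pow i) = y (k \<odot> a_pow i)" for i
        unfolding kw using k h(1) yh by (simp add: m_assoc)
    qed (use k h in simp)
    then show ?thesis using kw by metis
  qed
  show False
  proof (cases "\<bar>m\<bar> = \<bar>n\<bar>")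
    case False
    then have "h = bs_one"
      by (rule conjugate_exponents_descent) (use conj h in auto)
    then show False using h by blast
  next
    case True
    let ?b = "\<lambda>j::nat. bs_b [^]\<^bsub>BS m n\<^esub> j"
    have "\<forall>j. \<exists>i. h \<odot> ?b j = ?b j \<odot> a_pow i" using conj by simp
    from choice[OF this] obtain d where d: "\<And>j. h \<odot> ?b j = ?b j \<odot> a_pow (d j)" by blast
    have "n * d (Suc j) = m * d j" for j
    proof (rule a_pow_b_commute)
      have "?b j \<odot> (a_pow (d j) \<odot> bs_b) = h \<odot> ?b j \<odot> bs_b" by (simp add: d m_assoc)
      also have "\<dots> = h \<odot> ?b (Suc j)" using h by (simp add: m_assoc)
      also have "\<dots> = ?b j \<odot> (bs_b \<odot> a_pow (d (Suc j)))" unfolding d by (simp add: m_assoc)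
      finally show "a_pow (d j) \<odot> bs_b = bs_b \<odot> a_pow (d (Suc j))" by simp
    qed
    then have "\<bar>n\<bar> * \<bar>d (Suc j)\<bar> = \<bar>n\<bar> * \<bar>d j\<bar>" for j using True by (metis abs_mult)
    then have "\<bar>d (Suc j)\<bar> = \<bar>d j\<bar>" for j using n_nonzero by simp
    then have abs_d: "\<bar>d j\<bar> = \<bar>d 0\<bar>" for j by (induction j) auto
    define p where "p = \<bar>d 0\<bar>"
    have "d 0 \<noteq> 0" using d[of 0] h by auto
    then have p: "p > 0" by (simp add: p_def)
    have period_d: "y (?b j \<odot> a_pow (d j + i)) = y (?b j \<odot> a_pow i)" for i j
    proof -
      have "?b j \<odot> a_pow (d j + i) = ?b j \<odot> a_pow (d j) \<odot> a_pow i" by simp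
      also have "\<dots> = h \<odot> (?b j \<odot> a_pow i)" unfolding d[symmetric] using h by (simp add: m_assoc)
      finally show ?thesis using yh by simp
    qed
    \<comment> \<open>For m = -n the sign of \<open>d j\<close> alternates; the absolute value
      \<open>p\<close> is a period of all these rows.\<close>
    have period: "y (?b j \<odot> a_pow (i + p)) = y (?b j \<odot> a_pow i)" for i j
    proof (cases "d j = p")
      case True
      then show ?thesis using period_d[of j i] by (simp add: add.commute)
    next
      case False
      then have "d j = - p" using abs_d[of j] by (auto simp: p_def abs_if split: if_splits)
      then show ?thesis using period_d[of j "i + p"] by simp
    qed
    have period_mult: "y (?b j \<odot> a_pow (i + p * l)) = y (?b j \<odot> a_pow i)" for i j l
    proof (induction l rule: int_shift_induct)
      case (shift l)
      show ?case using period[of j "i + p * l"] by (simp add: distrib_left add.assoc)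
    qed simp
    have period_mod: "y (?b j \<odot> a_pow i) = y (?b j \<odot> a_pow (i mod p))" for i j
      using period_mult[of j "i mod p" "i div p"] by simp
    \<comment> \<open>By periodicity \<open>p\<close> symbols determine a row, so two of the rows
      coincide.\<close>
    let ?\<Phi> = "\<lambda>j. \<lambda>i\<in>{0..<p}. y (?b j \<odot> a_pow i)"
    have "range ?\<Phi> \<subseteq> {0..<p} \<rightarrow>\<^sub>E symbols"
      using valid_symbols[OF y] by auto
    then have "finite (range ?\<Phi>)"
      by (rule finite_subset) (intro finite_PiE finite_symbols finite_atLeastLessThan_int)
    then have "\<not> inj ?\<Phi>" using finite_imageD infinite_UNIV_nat by blast
    then obtain j j' where "j \<noteq> j'" "?\<Phi> j = ?\<Phi> j'" unfolding inj_on_def by blast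
    then obtain j j' where j: "j < j'" "?\<Phi> j = ?\<Phi> j'" by (metis linorder_neqE_nat)
    have "y (?b j \<odot> a_pow i) = y (?b j' \<odot> a_pow i)" for i
    proof -
      have "y (?b j \<odot> a_pow (i mod p)) = y (?b j' \<odot> a_pow (i mod p))"
        using fun_cong[OF j(2), of "i mod p"] p by (simp add: restrict_def)
      then show ?thesis using period_mod by metis
    qed
    then have "row y (?b j') = row y (?b j)" by (intro row_cong) simp
    moreover have "?b j' = ?b j \<odot> ?b (j' - j)" using j(1) by (simp add: nat_pow_mult)
    ultimately show False
      using rows_b_pow_distinct[OF y, of "?b j" "j' - j"] j(1) by simp
  qed
qed

end

section \<open>Subshifts that are weakly but not strongly aperiodic\<close>

lemma not_strongly_aperiodicI:
  assumes "group G" "x \<in> X" "x \<in> extensional (carrier G)" "h \<in> carrier G" "h \<noteq> \<one>\<^bsub>G\<^esub>"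
    and "\<And>g. g \<in> carrier G \<Longrightarrow> x (h \<otimes>\<^bsub>G\<^esub> g) = x g"
  shows "\<not> strongly_aperiodic G X"
  using assms group.weakly_periodic_iff[OF assms(1,3)] unfolding strongly_aperiodic_def by blast

context baumslag_solitar begin

text \<open>Equality with \<open>commutator_right\<close> would say that a commutes with b a
  b^-1.\<close>

definition "commutator_left = bs_a \<odot> bs_b \<odot> bs_a \<odot> bs_inv bs_b"
definition "commutator_right = bs_b \<odot> bs_a \<odot> bs_inv bs_b \<odot> bs_a"

text \<open>Let \<open>a\<close> act on the integers by a cycle on \<open>{0..<|m|}\<close> and \<open>b\<close> by translation.\<close>

lemma commutator_nontrivial:
  assumes eq: "\<bar>m\<bar> = \<bar>n\<bar>" and ge: "\<bar>m\<bar> \<ge> 2"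
  shows "commutator_left \<noteq> commutator_right"
proof
  assume comm: "commutator_left = commutator_right"
  define N where "N = \<bar>m\<bar>"
  have N: "N \<ge> 2" using ge by (simp add: N_def)
  define \<alpha> :: "int \<Rightarrow> int" where "\<alpha> x = (if 0 \<le> x \<and> x < N then (x + 1) mod N else x)" for x
  define \<alpha>' :: "int \<Rightarrow> int" where "\<alpha>' x = (if 0 \<le> x \<and> x < N then (x - 1) mod N else x)" for x
  have inv: "\<alpha>' (\<alpha> x) = x" "\<alpha> (\<alpha>' x) = x" for x
    using N by (auto simp: \<alpha>_def \<alpha>'_def mod_simps)
  have pow: "(\<alpha> ^^ j) x = (if 0 \<le> x \<and> x < N then (x + int j) mod N else x)" for j x
    using N by (induction j) (auto simp: \<alpha>_def mod_simps add_ac)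
  have "(\<alpha> ^^ nat N) x = x" for x
    using N unfolding pow by auto
  then have idN: "\<alpha> ^^ nat N = id" by auto
  have "\<alpha>' ^^ nat N = id"
  proof
    fix x
    have "(\<alpha>' ^^ j) ((\<alpha> ^^ j) x) = x" for j
      by (induction j arbitrary: x) (simp_all add: funpow_swap1 inv)
    then show "(\<alpha>' ^^ nat N) x = id x" using idN by (metis id_apply)
  qed
  then have ipow: "ipow \<alpha> \<alpha>' m x = x" "ipow \<alpha> \<alpha>' n x = x" for x
    using idN eq by (auto simp: ipow_def N_def abs_if split: if_splits)
  obtain act where act: "\<And>g h \<omega>. g \<in> bs_carrier \<Longrightarrow> h \<in> bs_carrier \<Longrightarrow> act (g \<odot> h) \<omega> = act h (act g \<omega>)"
    "\<And>k \<omega>. act (a_pow k) \<omega> = ipow \<alpha> \<alpha>' k \<omega>" "\<And>\<omega>. act bs_b \<omega> = \<omega> + 1" "\<And>\<omega>. act (bs_inv bs_b) \<omega> = \<omega> - (1::int)"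
    by (rule bs_action[of \<alpha>' \<alpha> "\<lambda>x. x - 1" "\<lambda>x. x + 1"]) (auto simp: inv ipow)
  have act_a: "act bs_a \<omega> = \<alpha> \<omega>" for \<omega>
    using act(2)[of 1 \<omega>] by (simp add: a_pow_1 ipow_def)
  \<comment> \<open>The left word moves N - 1 to 0, 1, \<alpha> 1, \<alpha> 1 - 1; the right word
    moves it to N, N, N - 1, 0, since \<alpha> fixes N.\<close>
  have "act commutator_left (N - 1) = act commutator_right (N - 1)" using comm by simp
  then have "\<alpha> 1 - 1 = 0"
    using N by (simp add: commutator_left_def commutator_right_def act act_a) (simp add: \<alpha>_def)
  then have "2 mod N = 1" using N by (simp add: \<alpha>_def)
  then show False using N by (cases "N = 2") auto
qed

end

text \<open>With constant turns, b sends (s, 2) to (\<epsilon> s, 4), where \<epsilon> = m/n is 1 or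
  -1. On states (s, 2) both a and b a b^-1 are translations, by 1 and by \<epsilon>. So their
  commutator fixes (0, 2) and the configuration read off from it.\<close>

lemma (in baumslag_solitar) weakly_not_strongly_equal:
  assumes eq: "\<bar>m\<bar> = \<bar>n\<bar>" and ge: "\<bar>m\<bar> \<ge> 2"
  shows "\<exists>(A :: nat set) X. is_SFT (BS m n) A X \<and> weakly_aperiodic (BS m n) X \<and> \<not> strongly_aperiodic (BS m n) X"
proof -
  interpret T: multiplier m n "\<lambda>_ _. 1" 1 by (rule trivial_multiplier)
  obtain act :: "bs_gen word set \<Rightarrow> real \<times> quat \<Rightarrow> real \<times> quat" where act:
    "\<And>\<omega>. act bs_one \<omega> = \<omega>"
    "\<And>g h \<omega>. g \<in> bs_carrier \<Longrightarrow> h \<in> bs_carrier \<Longrightarrow> act (g \<odot> h) \<omega> = act h (act g \<omega>)"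
    "\<And>k s v. act (a_pow k) (s, v) = (s + of_int k, v)"
    "\<And>\<omega>. act bs_b \<omega> = T.up \<omega>" "\<And>\<omega>. act (bs_inv bs_b) \<omega> = T.down \<omega>"
    by (rule T.state_action) blast
  define \<epsilon> where "\<epsilon> = (of_int m / of_int n :: real)"
  have \<epsilon>: "s * of_int m / of_int n = s * \<epsilon>" "s * of_int n / of_int m = s * \<epsilon>" "\<epsilon> * \<epsilon> = 1" for s
    using eq m_nonzero n_nonzero by (auto simp: \<epsilon>_def abs_eq_iff)
  have act_a: "act bs_a (s, v) = (s + 1, v)" for s v
    using act(3)[of 1 s v] by (simp add: a_pow_1)
  have up: "T.up (s, 2) = (s * \<epsilon>, 4)" for s
    by (simp add: T.up_def T.up_factor_def \<epsilon> scaleR_2)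
  have down: "T.down (s, 4) = (s * \<epsilon>, 2)" for s
  proof -
    have "(4::quat) = 2 *\<^sub>R 2" by (simp add: scaleR_2)
    have "(1 / 2) *\<^sub>R (4::quat) = 2" unfolding \<open>4 = 2 *\<^sub>R 2\<close> by simp
    then show ?thesis by (simp add: T.down_def T.down_factor_def \<epsilon>)
  qed
  define h where "h = commutator_left \<odot> bs_inv commutator_right"
  have closed: "commutator_left \<in> bs_carrier" "commutator_right \<in> bs_carrier"
    by (simp_all add: commutator_left_def commutator_right_def)
  have h: "h \<in> bs_carrier" by (simp add: h_def closed)
  have "h \<noteq> bs_one"
    using commutator_nontrivial[OF eq ge] closed by (metis h_def inv_closed inv_equality inv_inv)
  have "act commutator_left (0, 2) = act commutator_right (0, 2)"
    by (simp add: commutator_left_def commutator_right_def act act_a up down distrib_right \<epsilon>)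
  then have "act h (0, 2) = act (commutator_right \<odot> bs_inv commutator_right) (0, 2)"
    unfolding h_def using closed by (simp only: act inv_closed)
  then have act_h: "act h (0, 2) = (0, 2)" using closed by (simp add: act)
  let ?y = "\<lambda>g. T.state_symbol (act g (0, 2))"
  let ?x = "\<lambda>g\<in>bs_carrier. inv_into T.alphabet T.decode (?y g)"
  have "T.valid ?y"
    by (rule T.valid_state_symbol) (simp_all add: act)
  then have "?x \<in> T.subshift" by (rule T.valid_subshift)
  then have "\<not> strongly_aperiodic (BS m n) T.subshift"
    by (rule not_strongly_aperiodicI[OF group_axioms _ _ h \<open>h \<noteq> bs_one\<close>]) (simp_all add: h act act_h)
  then show ?thesis using T.is_SFT_subshift T.weakly_aperiodic_subshift by blast
qed

text \<open>For \<open>|m| \<noteq> |n|\<close> it suffices to count positions in each row modulo \<open>|m n|\<close>: if a power of \<open>a\<close>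
  fixed such a configuration, its exponent would be infinitely divisible. But \<open>b\<close> can fix one.\<close>

lemma (in baumslag_solitar) weakly_not_strongly_unequal:
  assumes ne: "\<bar>m\<bar> \<noteq> \<bar>n\<bar>"
  shows "\<exists>(A :: nat set) X. is_SFT (BS m n) A X \<and> weakly_aperiodic (BS m n) X \<and> \<not> strongly_aperiodic (BS m n) X"
proof -
  define N where "N = \<bar>m * n\<bar>"
  have N: "N > 0" "m dvd N" "n dvd N" using m_nonzero n_nonzero by (auto simp: N_def)
  define R where "R c \<longleftrightarrow> int (c bs_a) = (int (c bs_one) + 1) mod N" for c :: "bs_gen word set \<Rightarrow> nat"
  define A where "A = {0..<nat N}"
  define X where "X = {x \<in> bs_carrier \<rightarrow>\<^sub>E A. \<forall>g\<in>bs_carrier. R (\<lambda>p. x (g \<odot> p))}"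
  have "is_SFT (BS m n) A X"
    unfolding X_def by (rule is_SFT_local_rule[of _ "{bs_one, bs_a}"]) (auto simp: A_def R_def)
  obtain act :: "bs_gen word set \<Rightarrow> real \<Rightarrow> real" where act:
    "\<And>\<omega>. act bs_one \<omega> = \<omega>"
    "\<And>g h \<omega>. g \<in> bs_carrier \<Longrightarrow> h \<in> bs_carrier \<Longrightarrow> act (g \<odot> h) \<omega> = act h (act g \<omega>)"
    "\<And>k s. act (a_pow k) s = s + of_int k" "\<And>s. act bs_b s = s * of_int m / of_int n"
    by (rule affine_action) blast
  \<comment> \<open>As b fixes the point 0 of the affine action, it is a period of this
    configuration.\<close>
  define x where "x = (\<lambda>g\<in>bs_carrier. nat (\<lfloor>act g 0\<rfloor> mod N))"
  have "x \<in> X"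
    using N act(3)[of 1] by (auto simp: X_def x_def A_def R_def act a_pow_1 mod_simps nat_less_iff)
  have "bs_b \<noteq> bs_one"
  proof
    assume "bs_b = bs_one"
    then have "(1::real) * of_int m / of_int n = 1" using act(1,4) by metis
    then have "m = n" using n_nonzero by simp
    then show False using ne by simp
  qed
  have "\<not> strongly_aperiodic (BS m n) X"
    by (rule not_strongly_aperiodicI[OF group_axioms \<open>x \<in> X\<close> _ bs_b_closed \<open>bs_b \<noteq> bs_one\<close>])
      (simp_all add: x_def act)
  moreover have "weakly_aperiodic (BS m n) X"
    unfolding weakly_aperiodic_def
  proof (intro conjI ballI notI)
    show "False" if "X = {}" using that \<open>x \<in> X\<close> by blast
  next
    fix x assume x: "x \<in> X" and "strongly_periodic (BS m n) x"
    then obtain d0 :: nat where d0: "d0 > 0" "\<And>g. g \<in> bs_carrier \<Longrightarrow> x (bs_a [^]\<^bsub>BS m n\<^esub> d0 \<odot> g) = x g"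
      using strongly_periodic_pow[OF _ bs_a_closed] by blast
    define h where "h = a_pow (int d0)"
    have h: "x (h \<odot> g) = x g" if "g \<in> bs_carrier" for g
      using d0(2)[OF that] by (simp add: h_def a_pow_def int_pow_int)
    have count: "int (x (g \<odot> a_pow i)) = (int (x g) + i) mod N" if g: "g \<in> bs_carrier" for g i
    proof (induction i rule: int_shift_induct)
      case zero
      have "x g \<in> A" using x g by (auto simp: X_def)
      then show ?case using g by (simp add: A_def nat_less_iff)
    next
      case (shift i)
      have xA: "x (g \<odot> a_pow i) \<in> A" using x g by (auto simp: X_def)
      have "R (\<lambda>p. x (g \<odot> a_pow i \<odot> p))" using x g by (auto simp: X_def)
      then have "int (x (g \<odot> a_pow (i + 1))) = (int (x (g \<odot> a_pow i)) + 1) mod N"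
        using g by (simp add: R_def flip: a_pow_1)
      then have "int (x (g \<odot> a_pow (i + 1))) = (int (x g) + (i + 1)) mod N \<longleftrightarrow>
          int (x (g \<odot> a_pow i)) mod N = (int (x g) + i) mod N"
        by (simp add: mod_eq_dvd_iff algebra_simps)
      then show ?case using xA by (simp add: A_def nat_less_iff)
    qed
    have "h = bs_one"
    proof (rule conjugate_exponents_descent[OF ne])
      fix e and j :: nat
      show "\<exists>k. h \<odot> b_sgn e [^]\<^bsub>BS m n\<^esub> j = b_sgn e [^]\<^bsub>BS m n\<^esub> j \<odot> a_pow k"
      proof (induction j)
        case (Suc j)
        let ?c = "b_sgn e [^]\<^bsub>BS m n\<^esub> j"
        obtain k where k: "h \<odot> ?c = ?c \<odot> a_pow k" using Suc by blast
        \<comment> \<open>The period gives \<open>?c\<close> and its translate by a^k the same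
          count, so N divides k; a^k can then be moved past the next letter.\<close>
        have "(int (x ?c) + k) mod N = (int (x ?c) + 0) mod N"
          using count[of ?c k] count[of ?c 0] h[of ?c] k by simp
        then have "N dvd k" by (simp add: mod_eq_dvd_iff)
        then have "(if e then n else m) dvd k" using N by (auto intro: dvd_trans)
        then obtain l where l: "k = (if e then n else m) * l" by (auto elim: dvdE)
        have "a_pow k \<odot> b_sgn e = b_sgn e \<odot> a_pow ((if e then m else n) * l)"
          using b_a_pow[of l] b_inv_a_pow[of l] by (simp add: l b_sgn_def)
        then have step: "?c \<odot> (a_pow k \<odot> b_sgn e) = ?c \<odot> (b_sgn e \<odot> a_pow ((if e then m else n) * l))"
          by (rule arg_cong)
        have "h \<odot> b_sgn e [^]\<^bsub>BS m n\<^esub> Suc j = (h \<odot> ?c) \<odot> b_sgn e"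
          by (simp add: h_def m_assoc)
        also have "\<dots> = ?c \<odot> (a_pow k \<odot> b_sgn e)" unfolding k by (simp add: m_assoc)
        also have "\<dots> = b_sgn e [^]\<^bsub>BS m n\<^esub> Suc j \<odot> a_pow ((if e then m else n) * l)"
          unfolding step by (simp only: nat_pow_Suc m_assoc b_sgn_closed nat_pow_closed a_pow_closed)
        finally show ?case by blast
      qed (auto simp: h_def)
    qed (simp add: h_def)
    then show False using d0(1) a_pow_inj[of "int d0" 0] by (simp add: h_def)
  qed
  ultimately show ?thesis using \<open>is_SFT (BS m n) A X\<close> by blast
qed

theorem theorem4p5:
  fixes m n :: int
  assumes "m \<noteq> 0" and "n \<noteq> 0"
    and "\<bar>m\<bar> \<ge> 2 \<or> \<bar>n\<bar> \<ge> 2"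
    and "residually_finite (BS m n)"
  shows "(\<exists>(A :: nat set) X. is_SFT (BS m n) A X \<and> strongly_aperiodic (BS m n) X) \<and>
    (\<exists>(A :: nat set) X. is_SFT (BS m n) A X \<and> weakly_aperiodic (BS m n) X \<and>
      \<not> strongly_aperiodic (BS m n) X)"
proof
  interpret edge_subshift m n by unfold_locales (use assms in auto)
  show "\<exists>(A :: nat set) X. is_SFT (BS m n) A X \<and> strongly_aperiodic (BS m n) X"
    using is_SFT_subshift strongly_aperiodic_subshift by blast
  show "\<exists>(A :: nat set) X. is_SFT (BS m n) A X \<and> weakly_aperiodic (BS m n) X \<and>
      \<not> strongly_aperiodic (BS m n) X"
    using weakly_not_strongly_equal weakly_not_strongly_unequal assms(3) by fastforce
qed

end
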